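(* Every connected, nonhamiltonian, locally linear graph with at least $3$ vertices has at least $12$ vertices, and there exists a connected, nonhamiltonian, locally linear graph with exactly $12$ vertices. That is, the minimum order of a nonhamiltonian locally linear graph is $12$.
   Context: All graphs are finite, simple and connected. For a vertex $v$ of a graph $G$, $N(v)$ is the set of neighbours of $v$ and $G[S]$ is the subgraph induced by a vertex set $S$. A graph $G$ is locally linear if for every vertex $v$ of $G$ the induced subgraph $G[N(v)]$ is a path. A graph is hamiltonian if it contains a cycle through all of its vertices. *)

theory Defs
  imports "Graph_Theory.Graph_Theory"
begin

definition neighbourhood :: "('a, 'b) pre_digraph \<Rightarrow> 'a \<Rightarrow> 'a set" where
  "neighbourhood G v = {u. v \<rightarrow>\<^bsub>G\<^esub> u}"

(* The path x_0 - x_1 - ... - x_k with k >= 0, as a symmetric digraph; a single vertex is a path. *)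
definition path_graph :: "('a, 'b) pre_digraph \<Rightarrow> bool" where
  "path_graph H \<longleftrightarrow> (\<exists>xs. xs \<noteq> [] \<and> distinct xs \<and> verts H = set xs \<and>
     arcs_ends H = {(xs ! i, xs ! j) | i j.
       i < length xs \<and> j < length xs \<and> (j = Suc i \<or> i = Suc j)})"

definition locally_linear :: "('a, 'b) pre_digraph \<Rightarrow> bool" where
  "locally_linear G \<longleftrightarrow> (\<forall>v \<in> verts G. path_graph (G \<restriction> neighbourhood G v))"

(* The length bound is needed because traversing one edge back and forth is a cycle in the
   sense of pre_digraph.cycle. *)
definition hamiltonian :: "('a, 'b) pre_digraph \<Rightarrow> bool" where
  "hamiltonian G \<longleftrightarrow>
     (\<exists>p. pre_digraph.cycle G p \<and> 3 \<le> length p \<and> tail G ` set p = verts G)"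

end

theory Submission
  imports Defs
begin

text \<open>
  A locally linear graph triangulates a surface with every vertex on the boundary: the edges
  lying in exactly one triangle form disjoint cycles covering all vertices, each of length at
  least 4 unless it is the whole graph. One such cycle is hamiltonian and three need 12 vertices.
  With two boundary cycles \<open>A\<close> and \<open>B\<close>, boundary edges \<open>x x'\<close> of \<open>A\<close> and \<open>y y'\<close> of \<open>B\<close> joined by
  edges \<open>x y\<close> and \<open>x' y'\<close> (a ladder) let us splice the two cycles into a hamiltonian one. If
  there is no ladder and \<open>A\<close> has no chord, the apex in \<open>B\<close> of every edge of \<open>A\<close> carries two
  nonadjacent chords of \<open>B\<close> (a wedge), and going around \<open>A\<close> these apexes cannot all coincide.
  When \<open>B\<close> has at most 7 vertices, any two wedge centres are adjacent over a vertex of degree 2,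
  so at most two exist and they share at most one neighbour in \<open>A\<close>; but the apex changes at two
  different vertices of \<open>A\<close>. A 4-cycle \<open>A\<close> has no chord, and a 5-cycle at most one, which cuts
  off a vertex of degree 2; the same analysis on the remaining 4-cycle gives \<open>B\<close> at least 7
  vertices.

  The extremal graph is an annulus triangulated between a 4-cycle and a ring of 4 vertices, with
  a vertex of degree 2 glued to every ring edge. A hamiltonian cycle would have to enter every
  ring vertex from a degree 2 vertex and so could never leave the inner 4-cycle.
\<close>

section \<open>Cyclic lists\<close>

definition cyclic_list :: "('a \<Rightarrow> 'a \<Rightarrow> bool) \<Rightarrow> 'a list \<Rightarrow> bool" where
  "cyclic_list R xs \<longleftrightarrow>
     distinct xs \<and> 3 \<le> length xs \<and> successively R xs \<and> R (last xs) (hd xs)"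

lemma cyclic_list_mono:
  "\<lbrakk>cyclic_list R xs; \<And>x y. R x y \<Longrightarrow> Q x y\<rbrakk> \<Longrightarrow> cyclic_list Q xs"
  unfolding cyclic_list_def by (auto intro: successively_mono)

lemma cyclic_list_append_commute:
  assumes "cyclic_list R (xs @ ys)"
  shows "cyclic_list R (ys @ xs)"
  using assms unfolding cyclic_list_def
  by (cases "xs = []"; cases "ys = []") (auto simp: successively_append_iff)

lemma cyclic_list_rev:
  assumes "cyclic_list R xs" "\<And>x y. R x y \<Longrightarrow> R y x"
  shows "cyclic_list R (rev xs)"
proof -
  have "successively (\<lambda>x y. R y x) xs"
    using assms unfolding cyclic_list_def by (auto intro: successively_mono)
  then show ?thesis
    using assms unfolding cyclic_list_def by (auto simp: successively_rev hd_rev last_rev)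
qed

lemma cyclic_list_start:
  assumes "cyclic_list R xs" "x \<in> set xs"
  obtains ys where "cyclic_list R (x # ys)" "set (x # ys) = set xs" "length (x # ys) = length xs"
proof -
  obtain us ws where "xs = us @ x # ws" using split_list[OF assms(2)] by blast
  then show thesis
    using that[of "ws @ us"] cyclic_list_append_commute[of R us "x # ws"] assms(1) by auto
qed

lemma cyclic_list_around:
  assumes "cyclic_list R xs" "x \<in> set xs"
  obtains y ys z where "cyclic_list R (x # y # ys @ [z])" "set (x # y # ys @ [z]) = set xs"
proof -
  obtain zs where zs: "cyclic_list R (x # zs)" "set (x # zs) = set xs"
    using cyclic_list_start[OF assms] by metis
  then have "2 \<le> length zs" unfolding cyclic_list_def by simp
  then obtain y ys z where "zs = y # ys @ [z]"
    by (cases zs; cases "tl zs" rule: rev_cases) auto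
  then show thesis using that zs by blast
qed

lemma cyclic_list_nth_mod:
  assumes "cyclic_list R xs"
  shows "R (xs ! (i mod length xs)) (xs ! (Suc i mod length xs))"
proof (cases "Suc (i mod length xs) = length xs")
  case True
  then have "Suc i mod length xs = 0" "i mod length xs = length xs - 1" by (auto simp: mod_Suc)
  moreover have "xs \<noteq> []" using True by auto
  ultimately show ?thesis
    using assms unfolding cyclic_list_def by (metis hd_conv_nth last_conv_nth)
next
  case False
  have "0 < length xs" using assms unfolding cyclic_list_def by linarith
  then have "Suc (i mod length xs) < length xs" "Suc i mod length xs = Suc (i mod length xs)"
    using False by (auto simp: mod_Suc Suc_lessI)
  then show ?thesis using assms unfolding cyclic_list_def by (simp add: successively_conv_nth)
qed

lemma nth_mod_neq:
  assumes "distinct xs" "i < j" "j < i + length xs"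
  shows "xs ! (i mod length xs) \<noteq> xs ! (j mod length xs)"
proof
  have "0 < length xs" using assms(2,3) by linarith
  moreover assume "xs ! (i mod length xs) = xs ! (j mod length xs)"
  ultimately have "i mod length xs = j mod length xs"
    using assms(1) by (simp add: nth_eq_iff_index_eq)
  then have "length xs dvd j - i" using assms(2) mod_eq_dvd_iff_nat[of i j "length xs"] by simp
  then show False using assms(2,3) by (auto dest: dvd_imp_le)
qed

lemma periodic_changes_twice:
  fixes f :: "nat \<Rightarrow> 'a"
  assumes "0 < k" "f (i + k) = f i" "f i \<noteq> f (Suc i)"
  obtains j where "i < j" "j < i + k" "f j \<noteq> f (Suc j)"
proof (rule ccontr)
  assume "\<not> thesis"
  then have no_change: "\<forall>j. i < j \<longrightarrow> j < i + k \<longrightarrow> f (Suc j) = f j" using that by metis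
  have "f (Suc (i + d)) = f (Suc i)" if "d < k" for d
    using that by (induction d) (auto simp: no_change)
  from this[of "k - 1"] show False using assms by (cases k) auto
qed

lemma cyclic_list_label_cases:
  assumes xs: "cyclic_list R xs"
  obtains (uniform) l where "\<And>x. x \<in> set xs \<Longrightarrow> \<exists>y \<in> set xs. R x y \<and> f x y = l"
    | (changing) x y z x' y' z' where "y \<noteq> y'" "{x, y, z, x', y', z'} \<subseteq> set xs"
      "R x y" "R y z" "f x y \<noteq> f y z" "R x' y'" "R y' z'" "f x' y' \<noteq> f y' z'"
proof -
  define a where "a i = xs ! (i mod length xs)" for i
  define h where "h i = f (a i) (a (Suc i))" for i
  have pos: "0 < length xs" and dist: "distinct xs" using xs unfolding cyclic_list_def by auto
  have a_in: "a i \<in> set xs" for i unfolding a_def using pos by simp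
  have R: "R (a i) (a (Suc i))" for i unfolding a_def by (rule cyclic_list_nth_mod[OF xs])
  have period: "h (i + length xs) = h i" for i
    unfolding h_def a_def by (metis add_Suc mod_add_self2)
  show thesis
  proof (cases "\<forall>i. h i = h (Suc i)")
    case True
    have h: "h i = h 0" for i using True by (induction i) auto
    show thesis
    proof (rule uniform)
      fix x assume "x \<in> set xs"
      then obtain i where "x = a i" unfolding a_def by (metis in_set_conv_nth mod_less)
      then show "\<exists>y \<in> set xs. R x y \<and> f x y = h 0" using a_in R h[of i] unfolding h_def by blast
    qed
  next
    case False
    then obtain i where i: "h i \<noteq> h (Suc i)" by blast
    obtain j where j: "i < j" "j < i + length xs" "h j \<noteq> h (Suc j)"
      using periodic_changes_twice[OF pos period i] .
    have "a (Suc i) \<noteq> a (Suc j)"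
      unfolding a_def using dist j(1,2) by (intro nth_mod_neq) auto
    then show thesis
      by (rule changing[OF _ _ R R _ R R]) (use a_in i j(3) in \<open>auto simp: h_def\<close>)
  qed
qed

lemma successively_subset:
  assumes "successively R zs" "zs \<noteq> []" "hd zs \<in> S"
    and "\<And>x y. \<lbrakk>x \<in> S; R x y; y \<in> set zs\<rbrakk> \<Longrightarrow> y \<in> S"
  shows "set zs \<subseteq> S"
  using assms
proof (induction zs)
  case (Cons z zs)
  show ?case
  proof (cases zs)
    case (Cons y ys)
    then have "y \<in> S" using Cons.prems(1,3) Cons.prems(4)[of z y] by simp
    then have "set zs \<subseteq> S" using Cons.IH Cons.prems(1,4) \<open>zs = y # ys\<close> by auto
    then show ?thesis using Cons.prems(3) by simp
  qed (use Cons.prems(3) in simp)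
qed simp

section \<open>Cycles in 2-regular graphs\<close>

locale two_regular =
  fixes V :: "'a set" and R :: "'a \<Rightarrow> 'a \<Rightarrow> bool"
  assumes finite_V: "finite V"
    and R_in_V: "R u v \<Longrightarrow> v \<in> V"
    and R_sym: "R u v \<Longrightarrow> R v u"
    and R_irrefl: "\<not> R v v"
    and card_neighbours: "v \<in> V \<Longrightarrow> card {u. R v u} = 2"
begin

lemma neighbours_le_2:
  assumes "R v x" "R v y" "R v z"
  shows "x = y \<or> x = z \<or> y = z"
proof -
  have "card {u. R v u} = 2" using card_neighbours R_in_V R_sym assms(1) by blast
  then obtain a b where "{u. R v u} = {a, b}" by (auto simp: card_2_iff)
  then have "u = a \<or> u = b" if "R v u" for u using that by blast
  then show ?thesis using assms by metis
qed

lemma maximal_path_cyclic: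
  assumes "distinct xs" "xs \<noteq> []" "successively R xs" "set xs \<subseteq> V"
    and maximal: "\<And>y. R (last xs) y \<Longrightarrow> y \<in> set xs"
  shows "cyclic_list R xs"
proof -
  have "card {u. R (last xs) u} = 2" using card_neighbours assms(2,4) last_in_set by blast
  then obtain w where w: "R (last xs) w" "w \<noteq> last (butlast xs)"
    by (metis card_2_iff' mem_Collect_eq)
  obtain us ws where split: "xs = us @ w # ws" using split_list[OF maximal[OF w(1)]] by blast
  have "ws \<noteq> []" using w(1) R_irrefl split by auto
  then obtain w' ws' where ws: "ws = w' # ws'" by (cases ws) auto
  then have "ws' \<noteq> []" using w(2) split by (auto simp: butlast_append)
  have "us = []"
  proof (rule ccontr)
    assume "us \<noteq> []"
    then have "R w (last us)" "R w w'" "R w (last xs)"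
      using assms(3) w(1) R_sym unfolding split ws by (auto simp: successively_append_iff)
    moreover have "last us \<noteq> w'" "last us \<noteq> last xs" "w' \<noteq> last xs"
      using assms(1) last_in_set[OF \<open>us \<noteq> []\<close>] last_in_set[OF \<open>ws' \<noteq> []\<close>] unfolding split ws
      by auto
    ultimately show False using neighbours_le_2 by blast
  qed
  then show ?thesis
    using assms(1,3) w(1) split ws \<open>ws' \<noteq> []\<close> unfolding cyclic_list_def
    by (cases ws') (auto simp: Suc_le_eq)
qed

lemma cycle_exists:
  assumes "v \<in> V"
  obtains xs where "cyclic_list R xs" "v \<in> set xs" "set xs \<subseteq> V"
proof -
  define path_from_v where "path_from_v xs \<longleftrightarrow>
    distinct xs \<and> xs \<noteq> [] \<and> hd xs = v \<and> successively R xs \<and> set xs \<subseteq> V" for xs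
  have "path_from_v [v]" unfolding path_from_v_def using assms by simp
  moreover have "\<forall>xs. path_from_v xs \<longrightarrow> length xs < Suc (card V)"
    unfolding path_from_v_def using finite_V by (metis card_mono distinct_card le_imp_less_Suc)
  ultimately obtain xs where xs: "path_from_v xs"
    and longest: "\<And>ys. path_from_v ys \<Longrightarrow> length ys \<le> length xs"
    using ex_has_greatest_nat[of path_from_v "[v]" length] by metis
  have "y \<in> set xs" if "R (last xs) y" for y
  proof (rule ccontr)
    assume "y \<notin> set xs"
    then have "path_from_v (xs @ [y])"
      using xs that R_in_V unfolding path_from_v_def by (auto simp: successively_append_iff)
    then show False using longest by fastforce
  qed
  then have "cyclic_list R xs"
    using xs unfolding path_from_v_def by (intro maximal_path_cyclic) auto
  then show thesis using that xs hd_in_set unfolding path_from_v_def by blast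
qed

lemma cycle_closed:
  assumes "cyclic_list R xs" "x \<in> set xs" "R x y"
  shows "y \<in> set xs"
proof -
  obtain u us w where "cyclic_list R (x # u # us @ [w])" "set (x # u # us @ [w]) = set xs"
    using cyclic_list_around[OF assms(1,2)] .
  moreover from this have "R x u" "R x w" "u \<noteq> w" using R_sym unfolding cyclic_list_def by auto
  ultimately show ?thesis using neighbours_le_2 assms(3) by fastforce
qed

lemma cycle_through_edge:
  assumes "cyclic_list R xs" "x \<in> set xs" "R x y"
  obtains ys where "cyclic_list R ys" "set ys = set xs" "hd ys = x" "last ys = y"
proof -
  obtain u us w where around: "cyclic_list R (x # u # us @ [w])" "set (x # u # us @ [w]) = set xs"
    using cyclic_list_around[OF assms(1,2)] .
  then have "R x u" "R x w" "u \<noteq> w" using R_sym unfolding cyclic_list_def by auto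
  then consider "y = u" | "y = w" using neighbours_le_2 assms(3) by metis
  then show thesis
  proof cases
    assume "y = u"
    have "cyclic_list R (rev ((u # us @ [w]) @ [x]))"
      using cyclic_list_append_commute[of R "[x]" "u # us @ [w]"] around(1) R_sym
      by (intro cyclic_list_rev) auto
    then show thesis by (rule that) (use around(2) \<open>y = u\<close> in auto)
  next
    assume "y = w"
    then show thesis using that around by simp
  qed
qed

lemma cycle_subset:
  assumes xs: "cyclic_list R xs" "x \<in> set xs"
    and S: "x \<in> S" "\<And>y z. \<lbrakk>y \<in> S; R y z\<rbrakk> \<Longrightarrow> z \<in> S"
  shows "set xs \<subseteq> S"
proof -
  obtain zs where "cyclic_list R (x # zs)" "set (x # zs) = set xs"
    using cyclic_list_start[OF xs] by metis
  then show ?thesis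
    using successively_subset[of R "x # zs" S] S unfolding cyclic_list_def by auto
qed

lemma cycles_disjoint:
  assumes xs: "cyclic_list R xs" and ys: "cyclic_list R ys" and v: "v \<in> set ys" "v \<notin> set xs"
  shows "set xs \<inter> set ys = {}"
  using cycle_subset[OF ys v(1), of "- set xs"] v(2) cycle_closed[OF xs] R_sym by blast

end

section \<open>Links and boundary edges\<close>

definition link :: "('a \<Rightarrow> 'a \<Rightarrow> bool) \<Rightarrow> 'a \<Rightarrow> 'a list \<Rightarrow> bool" where
  "link E v xs \<longleftrightarrow> xs \<noteq> [] \<and> distinct xs \<and> set xs = {u. E v u} \<and>
     (\<forall>i < length xs. \<forall>j < length xs. E (xs ! i) (xs ! j) \<longleftrightarrow> j = Suc i \<or> i = Suc j)"

lemma link_rev: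
  assumes "link E v xs"
  shows "link E v (rev xs)"
  using assms unfolding link_def by (auto simp: rev_nth)

lemma link_adj_iff:
  assumes "link E v (us @ x # ws @ y # zs)"
  shows "E x y \<longleftrightarrow> ws = []"
proof -
  let ?xs = "us @ x # ws @ y # zs" and ?i = "length us" and ?j = "length (us @ x # ws)"
  have "?xs ! ?i = x" "?xs ! ?j = y"
    using nth_append_length[of us x] nth_append_length[of "us @ x # ws" y zs] by simp_all
  moreover have "?i < length ?xs" "?j < length ?xs" by simp_all
  ultimately have "E x y \<longleftrightarrow> ?j = Suc ?i \<or> ?i = Suc ?j"
    using assms unfolding link_def by metis
  then show ?thesis by simp
qed

lemma link_separated:
  assumes "link E v (us @ y # ws)" "x \<in> set us" "x' \<in> set ws"
  shows "\<not> E x x'"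
proof -
  obtain as bs cs ds where "us = as @ x # bs" "ws = cs @ x' # ds"
    using split_list[OF assms(2)] split_list[OF assms(3)] by blast
  then show ?thesis using link_adj_iff[of E v as x "bs @ y # cs" x' ds] assms(1) by simp
qed

locale locally_linear_graph =
  fixes V :: "'a set" and E :: "'a \<Rightarrow> 'a \<Rightarrow> bool"
  assumes finite_V: "finite V"
    and card_V: "3 \<le> card V"
    and E_in_V: "E u v \<Longrightarrow> u \<in> V"
    and E_sym: "E u v \<Longrightarrow> E v u"
    and E_irrefl: "\<not> E v v"
    and link_exists: "v \<in> V \<Longrightarrow> \<exists>xs. link E v xs"
    and edge_out: "\<lbrakk>S \<subseteq> V; S \<noteq> {}; S \<noteq> V\<rbrakk> \<Longrightarrow> \<exists>u \<in> S. \<exists>w \<in> V - S. E u w"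
begin

definition bd :: "'a \<Rightarrow> 'a \<Rightarrow> bool" where
  "bd u v \<longleftrightarrow> E u v \<and> (\<exists>!w. E u w \<and> E v w)"

definition chord :: "'a \<Rightarrow> 'a \<Rightarrow> bool" where
  "chord u v \<longleftrightarrow> E u v \<and> \<not> bd u v"

definition chordless :: "'a set \<Rightarrow> bool" where
  "chordless S \<longleftrightarrow> (\<forall>x \<in> S. \<forall>y \<in> S. \<not> chord x y)"

lemma E_in_V2: "E u v \<Longrightarrow> v \<in> V"
  using E_sym E_in_V by blast

lemma bd_E: "bd u v \<Longrightarrow> E u v"
  unfolding bd_def by blast

lemma bd_sym: "bd u v \<Longrightarrow> bd v u"
  unfolding bd_def using E_sym by blast

lemma bd_apex: "bd u v \<Longrightarrow> \<exists>w. E u w \<and> E v w"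
  unfolding bd_def by blast

lemma bd_apex_unique:
  "\<lbrakk>bd u v; E u w; E v w; E u w'; E v w'\<rbrakk> \<Longrightarrow> w = w'"
  unfolding bd_def by blast

lemma chord_sym: "chord u v \<Longrightarrow> chord v u"
  unfolding chord_def using E_sym bd_sym by blast

lemma chord_irrefl: "\<not> chord v v"
  unfolding chord_def using E_irrefl by blast

lemma bd_not_chord: "bd u v \<Longrightarrow> \<not> chord u v \<and> \<not> chord v u"
  unfolding chord_def using bd_sym by blast

lemma closed_eq_V:
  assumes "S \<subseteq> V" "S \<noteq> {}" "\<And>u. u \<in> S \<Longrightarrow> {w. E u w} \<subseteq> S"
  shows "S = V"
  using edge_out[OF assms(1,2)] assms(3) by blast

lemma link_split:
  assumes "E v x"
  obtains us ws where "link E v (us @ x # ws)"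
proof -
  obtain xs where "link E v xs" using link_exists E_in_V assms by blast
  then show thesis using that assms unfolding link_def by (metis mem_Collect_eq split_list)
qed

lemma link_common_neighbour_iff:
  assumes "link E v (us @ x # ws)"
  shows "E v y \<and> E x y \<longleftrightarrow> us \<noteq> [] \<and> y = last us \<or> ws \<noteq> [] \<and> y = hd ws"
proof
  assume y: "E v y \<and> E x y"
  then have "y \<in> set us \<or> y \<in> set ws"
    using assms E_irrefl unfolding link_def
    by (metis Un_iff mem_Collect_eq set_ConsD set_append)
  then show "us \<noteq> [] \<and> y = last us \<or> ws \<noteq> [] \<and> y = hd ws"
  proof
    assume "y \<in> set us"
    then obtain as bs where us: "us = as @ y # bs" by (metis split_list)
    then show ?thesis using link_adj_iff[of E v as y bs x ws] assms y E_sym by auto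
  next
    assume "y \<in> set ws"
    then obtain as bs where ws: "ws = as @ y # bs" by (metis split_list)
    then show ?thesis using link_adj_iff[of E v us x as y bs] assms y by auto
  qed
next
  have nb: "set (us @ x # ws) = {u. E v u}" using assms unfolding link_def by blast
  assume "us \<noteq> [] \<and> y = last us \<or> ws \<noteq> [] \<and> y = hd ws"
  then show "E v y \<and> E x y"
  proof
    assume "us \<noteq> [] \<and> y = last us"
    then obtain as where "us = as @ [y]" by (metis append_butlast_last_id)
    then show ?thesis using link_adj_iff[of E v as y "[]" x ws] assms nb E_sym by auto
  next
    assume "ws \<noteq> [] \<and> y = hd ws"
    then obtain bs where "ws = y # bs" by (metis list.collapse)
    then show ?thesis using link_adj_iff[of E v us x "[]" y bs] assms nb by auto
  qed
qed

lemma link_split_edge: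
  assumes "E v x" "E v x'" "E x x'"
  obtains us y y' ws where "link E v (us @ y # y' # ws)" "{y, y'} = {x, x'}"
proof -
  obtain us ws where link: "link E v (us @ x # ws)" using link_split[OF assms(1)] .
  consider "us \<noteq> []" "x' = last us" | "ws \<noteq> []" "x' = hd ws"
    using link_common_neighbour_iff[OF link] assms(2,3) by blast
  then show thesis
  proof cases
    assume "us \<noteq> []" "x' = last us"
    then obtain as where "us = as @ [x']" by (metis append_butlast_last_id)
    then show thesis using that[of as x' x ws] link by auto
  next
    assume "ws \<noteq> []" "x' = hd ws"
    then obtain bs where "ws = x' # bs" by (metis list.collapse)
    then show thesis using that[of us x x' bs] link by auto
  qed
qed

text \<open>A vertex of degree 1 and its neighbour would form a component of order 2.\<close>

lemma link_length:
  assumes "link E v xs"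
  shows "2 \<le> length xs"
proof (rule ccontr)
  assume "\<not> ?thesis"
  then obtain u where "xs = [u]" using assms unfolding link_def by (cases xs; cases "tl xs") auto
  then have v: "E v w \<longleftrightarrow> w = u" for w using assms unfolding link_def by auto
  then have uv: "E u v" using E_sym by blast
  obtain us ws where uws: "link E u (us @ v # ws)" using link_split[OF uv] .
  have "\<not> (E u w \<and> E v w)" for w using v E_irrefl by metis
  then have "us = []" "ws = []" using link_common_neighbour_iff[OF uws] by blast+
  then have "E u w \<longleftrightarrow> w = v" for w using uws unfolding link_def by auto
  then have "{u, v} = V" using v uv E_in_V E_in_V2 by (intro closed_eq_V) auto
  moreover have "card {u, v} \<le> 2" by (simp add: card_insert_if)
  ultimately show False using card_V by simp
qed

lemma common_neighbour_exists:
  assumes "E u v"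
  obtains w where "E u w" "E v w"
proof -
  obtain us ws where uws: "link E u (us @ v # ws)" using link_split[OF assms] .
  then have "us \<noteq> [] \<or> ws \<noteq> []" using link_length[OF uws] by auto
  then show thesis using that link_common_neighbour_iff[OF uws] by blast
qed

lemma common_neighbours_le_2:
  assumes "E u v" "E u w1" "E v w1" "E u w2" "E v w2" "E u w3" "E v w3"
  shows "w1 = w2 \<or> w1 = w3 \<or> w2 = w3"
proof -
  obtain us ws where uws: "link E u (us @ v # ws)" using link_split[OF assms(1)] .
  show ?thesis
    using link_common_neighbour_iff[OF uws, of w1] link_common_neighbour_iff[OF uws, of w2]
      link_common_neighbour_iff[OF uws, of w3] assms(2-7) by blast
qed

lemma chord_common_neighbours:
  assumes "chord u v"
  obtains w w' where "w \<noteq> w'" "E u w" "E v w" "E u w'" "E v w'"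
  using assms common_neighbour_exists unfolding chord_def bd_def by metis

lemma link_bd_iff:
  assumes "link E v (us @ x # ws)"
  shows "bd v x \<longleftrightarrow> us = [] \<or> ws = []"
proof -
  have "E v x" using assms unfolding link_def by auto
  moreover have "last us \<noteq> hd ws" if "us \<noteq> []" "ws \<noteq> []"
    using assms last_in_set[OF that(1)] hd_in_set[OF that(2)] unfolding link_def by auto
  moreover have "us \<noteq> [] \<or> ws \<noteq> []" using link_length[OF assms] by auto
  ultimately show ?thesis
    unfolding bd_def link_common_neighbour_iff[OF assms] by metis
qed

lemma link_bd_iff_end:
  assumes xs: "link E v xs"
  shows "bd v x \<longleftrightarrow> x = hd xs \<or> x = last xs"
proof -
  have ends: "bd v (hd xs)" "bd v (last xs)"
    using link_bd_iff[of v "[]" "hd xs" "tl xs"] link_bd_iff[of v "butlast xs" "last xs" "[]"] xs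
    unfolding link_def by auto
  have "x = hd xs \<or> x = last xs" if "bd v x"
  proof -
    have "x \<in> set xs" using xs bd_E[OF that] unfolding link_def by blast
    then obtain us ws where "xs = us @ x # ws" by (metis split_list)
    then show ?thesis using link_bd_iff[of v us x ws] xs that by auto
  qed
  then show ?thesis using ends by blast
qed

sublocale boundary: two_regular V bd
proof
  fix v assume "v \<in> V"
  then obtain xs where xs: "link E v xs" using link_exists by blast
  then have "{u. bd v u} = {hd xs, last xs}" using link_bd_iff_end by auto
  moreover have "hd xs \<noteq> last xs"
    using xs link_length[OF xs] unfolding link_def by (cases xs) auto
  ultimately show "card {u. bd v u} = 2" by simp
qed (use finite_V E_in_V2 bd_E bd_sym E_irrefl in blast)+

lemma link_acyclic:
  assumes ys: "cyclic_list E ys"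
  shows "\<exists>y \<in> set ys. \<not> E v y"
proof (rule ccontr)
  assume "\<not> ?thesis"
  then have all: "\<And>y. y \<in> set ys \<Longrightarrow> E v y" by blast
  obtain y where y: "y \<in> set ys" using ys unfolding cyclic_list_def by (cases ys) auto
  obtain xs where xs: "link E v xs" using link_exists E_in_V all[OF y] by blast
  then have "\<exists>x \<in> set xs. x \<in> set ys" using all[OF y] y unfolding link_def by blast
  then obtain us x ws where split: "xs = us @ x # ws" "x \<in> set ys" "\<forall>u \<in> set us. u \<notin> set ys"
    using split_list_first_prop[of xs "\<lambda>x. x \<in> set ys"] by blast
  obtain p zs q where around: "cyclic_list E (x # p # zs @ [q])" "set (x # p # zs @ [q]) = set ys"
    using cyclic_list_around[OF ys split(2)] .
  then have "E x p" "E x q" "p \<noteq> q" using E_sym unfolding cyclic_list_def by auto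
  moreover have "p \<in> set ys" "q \<in> set ys" using around(2) by auto
  ultimately show False
    using link_common_neighbour_iff[of v us x ws] xs split all last_in_set by metis
qed

lemma link_path_covers:
  assumes ends: "bd v (hd zs)" "bd v (last zs)" "hd zs \<noteq> last zs"
    and zs: "zs \<noteq> []" "successively E zs" "set zs \<subseteq> {u. E v u}"
  shows "{u. E v u} = set zs"
proof (rule ccontr)
  assume "\<not> ?thesis"
  then obtain y where y: "E v y" "y \<notin> set zs" using zs(3) by auto
  obtain us ws where xs: "link E v (us @ y # ws)" using link_split[OF y(1)] .
  have neq: "hd zs \<noteq> y" "last zs \<noteq> y" using y(2) zs(1) by auto
  let ?x = "hd (us @ y # ws)" and ?x' = "last (us @ y # ws)"
  have bd: "hd zs = ?x \<and> last zs = ?x' \<or> hd zs = ?x' \<and> last zs = ?x"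
    using link_bd_iff_end[OF xs] ends by metis
  then have "us \<noteq> []" "ws \<noteq> []" using neq by auto
  then have bd': "hd zs = hd us \<and> last zs = last ws \<or> hd zs = last ws \<and> last zs = hd us"
    using bd by auto
  have far: "\<not> E x x' \<and> \<not> E x' x" if "x \<in> set us" "x' \<in> set ws" for x x'
    using link_separated[OF xs that] E_sym by blast
  have inside: "x \<in> set us \<or> x \<in> set ws" if "x \<in> set zs" for x
    using that xs zs(3) y(2) unfolding link_def by auto
  have disj: "set us \<inter> set ws = {}" using xs unfolding link_def by auto
  have "set zs \<subseteq> set us \<or> set zs \<subseteq> set ws"
    using bd'
  proof
    assume "hd zs = hd us \<and> last zs = last ws"
    then have "set zs \<subseteq> set us"
      using zs(1,2) \<open>us \<noteq> []\<close> inside far by (intro successively_subset[of E]) auto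
    then show ?thesis ..
  next
    assume "hd zs = last ws \<and> last zs = hd us"
    then have "set zs \<subseteq> set ws"
      using zs(1,2) \<open>ws \<noteq> []\<close> inside far by (intro successively_subset[of E]) auto
    then show ?thesis ..
  qed
  then show False
    using bd' disj zs(1) \<open>us \<noteq> []\<close> \<open>ws \<noteq> []\<close> hd_in_set last_in_set by (metis disjoint_iff subsetD)
qed

lemma ear_neighbours:
  assumes "bd v u" "bd v w" "E u w" "E v z"
  shows "z = u \<or> z = w"
proof -
  have "{z. E v z} = set [u, w]"
    by (rule link_path_covers) (use assms bd_E E_irrefl in auto)
  then show ?thesis using assms(4) by auto
qed

lemma ear_no_chord:
  assumes "bd v u" "bd v w" "E u w"
  shows "\<not> chord v z" "\<not> chord z v"
  using ear_neighbours[OF assms, of z] assms(1,2) chord_sym unfolding chord_def by blast+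

section \<open>Boundary cycles\<close>

text \<open>A fan triangulates the polygon bounded by the cycle, so that no edge can leave it.\<close>

lemma bd_cycle_fan_neighbours:
  assumes cycle: "cyclic_list bd (x # as @ u # bs)"
    and fan: "\<And>y. y \<in> set (as @ u # bs) \<Longrightarrow> E x y"
  shows "{w. E u w} \<subseteq> {x} \<union> set as \<union> set bs"
proof -
  have dist: "distinct (x # as @ u # bs)" and path: "successively bd (x # as @ u # bs)"
    and closing: "bd (last (u # bs)) x"
    using cycle unfolding cyclic_list_def by auto
  define zs where
    "zs = (if as = [] then [] else [last as]) @ x # (if bs = [] then [] else [hd bs])"
  have "{w. E u w} = set zs"
  proof (rule link_path_covers)
    show "bd u (hd zs)"
      using path bd_sym unfolding zs_def by (auto simp: successively_Cons successively_append_iff)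
    show "bd u (last zs)"
      using path closing unfolding zs_def
      by (auto simp: successively_Cons successively_append_iff)
    show "hd zs \<noteq> last zs"
      using cycle dist unfolding zs_def cyclic_list_def by (auto dest: last_in_set hd_in_set)
    show "successively E zs" using fan E_sym unfolding zs_def by auto
    have "E u x" using fan E_sym by auto
    then show "set zs \<subseteq> {w. E u w}"
      using path bd_E E_sym unfolding zs_def
      by (auto simp: successively_Cons successively_append_iff)
  qed (simp add: zs_def)
  then show ?thesis unfolding zs_def by auto
qed

lemma bd_cycle_fan_covers:
  assumes cycle: "cyclic_list bd (x # ys)" and fan: "\<And>y. y \<in> set ys \<Longrightarrow> E x y"
  shows "set (x # ys) = V"
proof (rule closed_eq_V)
  have "ys \<noteq> []" using cycle unfolding cyclic_list_def by auto
  then have "x \<in> V" using fan[OF hd_in_set] E_in_V by blast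
  moreover have "y \<in> V" if "y \<in> set ys" for y using fan[OF that] E_in_V2 by blast
  ultimately show "set (x # ys) \<subseteq> V" by auto
  have "2 \<le> length ys" "distinct ys" "bd x (hd ys)" "bd x (last ys)" "successively bd ys"
    using cycle \<open>ys \<noteq> []\<close> bd_sym unfolding cyclic_list_def by (auto simp: successively_Cons)
  moreover from this have "hd ys \<noteq> last ys" by (cases ys) auto
  ultimately have "{w. E x w} = set ys"
    using fan successively_mono[of bd ys E] bd_E by (intro link_path_covers) auto
  moreover have "{w. E u w} \<subseteq> set (x # ys)" if u: "u \<in> set ys" for u
  proof -
    obtain as bs where "ys = as @ u # bs" using u by (auto dest: split_list)
    then show ?thesis using bd_cycle_fan_neighbours[of x as u bs] cycle fan by auto
  qed
  ultimately show "{w. E u w} \<subseteq> set (x # ys)" if "u \<in> set (x # ys)" for u using that by auto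
qed simp

lemma bd_cycle_length:
  assumes xs: "cyclic_list bd xs" "set xs \<noteq> V"
  shows "4 \<le> length xs"
proof (rule ccontr)
  assume "\<not> ?thesis"
  then have "length xs = Suc (Suc (Suc 0))" using xs(1) unfolding cyclic_list_def by auto
  then obtain x y z where xyz: "xs = [x, y, z]" by (auto simp: length_Suc_conv)
  then have "E x y" "E x z" using xs(1) bd_E E_sym unfolding cyclic_list_def by auto
  then show False using bd_cycle_fan_covers[of x "[y, z]"] xs xyz by auto
qed

definition ladder_free :: "'a set \<Rightarrow> 'a set \<Rightarrow> bool" where
  "ladder_free S T \<longleftrightarrow> (\<forall>x \<in> S. \<forall>x' \<in> S. \<forall>y \<in> T. \<forall>y' \<in> T.
     \<not> (bd x x' \<and> bd y y' \<and> E x y \<and> E x' y'))"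

lemma ladder_free_sym: "ladder_free S T \<Longrightarrow> ladder_free T S"
  unfolding ladder_free_def using E_sym by blast

lemma ladder_hamiltonian:
  assumes xs: "cyclic_list bd xs" and ys: "cyclic_list bd ys"
    and disjoint: "set xs \<inter> set ys = {}"
    and ladder: "\<not> ladder_free (set xs) (set ys)"
  obtains zs where "cyclic_list E zs" "set zs = set xs \<union> set ys"
proof -
  obtain x x' y y' where rungs: "x \<in> set xs" "x' \<in> set xs" "y \<in> set ys" "y' \<in> set ys"
    "bd x x'" "bd y y'" "E x y" "E x' y'"
    using ladder unfolding ladder_free_def by blast
  obtain us where us: "cyclic_list bd us" "set us = set xs" "hd us = x'" "last us = x"
    using boundary.cycle_through_edge[OF xs rungs(2) bd_sym[OF rungs(5)]] .
  obtain ws where ws: "cyclic_list bd ws" "set ws = set ys" "hd ws = y" "last ws = y'"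
    using boundary.cycle_through_edge[OF ys rungs(3,6)] .
  have "successively E us" "successively E ws"
    using us(1) ws(1) unfolding cyclic_list_def by (auto intro: successively_mono bd_E)
  moreover have "us \<noteq> []" "ws \<noteq> []" using us(1) ws(1) unfolding cyclic_list_def by auto
  ultimately have "cyclic_list E (us @ ws)"
    using us ws rungs disjoint E_sym unfolding cyclic_list_def
    by (auto simp: successively_append_iff)
  then show thesis using that us ws by auto
qed

end

section \<open>Two boundary cycles without a ladder\<close>

locale two_boundary_cycles = locally_linear_graph +
  fixes as bs :: "'a list"
  assumes as_cycle: "cyclic_list bd as" and bs_cycle: "cyclic_list bd bs"
    and disjoint: "set as \<inter> set bs = {}" and cover: "set as \<union> set bs = V"
    and no_ladder: "ladder_free (set as) (set bs)"
begin

abbreviation "A \<equiv> set as"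
abbreviation "B \<equiv> set bs"

definition facing_chord :: "'a \<Rightarrow> 'a \<Rightarrow> bool" where
  "facing_chord c p \<longleftrightarrow> c \<in> B \<and> p \<in> B \<and> chord c p \<and> (\<exists>a \<in> A. E c a \<and> E p a)"

definition wedge :: "'a \<Rightarrow> 'a \<Rightarrow> 'a \<Rightarrow> bool" where
  "wedge c p q \<longleftrightarrow> facing_chord c p \<and> facing_chord c q \<and> p \<noteq> q \<and> \<not> E p q"

lemma not_B_iff: "v \<in> V \<Longrightarrow> v \<notin> B \<longleftrightarrow> v \<in> A"
  using disjoint cover by blast

lemma A_proper: "A \<subset> V"
proof -
  have "bs \<noteq> []" using bs_cycle unfolding cyclic_list_def by auto
  then show ?thesis using cover disjoint by (cases bs) auto
qed

lemma mixed_chord: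
  assumes "x \<in> A" "y \<in> B" "E x y"
  shows "chord x y"
  using boundary.cycle_closed[OF as_cycle assms(1)] assms disjoint unfolding chord_def by blast

lemma rung_not_bd:
  "\<lbrakk>x \<in> A; x' \<in> A; bd x x'; y \<in> B; y' \<in> B; E x y; E x' y'\<rbrakk> \<Longrightarrow> \<not> bd y y'"
  using no_ladder unfolding ladder_free_def by blast

lemma link_run_end:
  assumes "link E c (us @ p # x # x' # ws)" and c: "c \<in> B" and p: "p \<in> B"
    and x: "x \<in> A" "x' \<in> A" "bd x x'"
  shows "facing_chord c p"
proof -
  have "E p x" using link_adj_iff[of E c us p "[]" x "x' # ws"] assms(1) by simp
  moreover have "E c p" "E c x" "E c x'" using assms(1) unfolding link_def by auto
  moreover have "\<not> bd p c" by (rule rung_not_bd[OF x p c]) (use calculation E_sym in auto)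
  ultimately show ?thesis using c p x(1) bd_sym unfolding facing_chord_def chord_def by blast
qed

lemma link_run_exists:
  assumes c: "c \<in> B" and x: "x \<in> A" "x' \<in> A" "E c x" "E c x'" "E x x'"
  obtains us p run q ws where "link E c (us @ p # run @ q # ws)" "p \<in> B" "q \<in> B"
    "set run \<subseteq> A" "2 \<le> length run"
proof -
  obtain us y y' ws where link: "link E c (us @ y # y' # ws)" and "{y, y'} = {x, x'}"
    using link_split_edge[OF x(3-5)] .
  then have y: "y \<in> A" "y' \<in> A" using x(1,2) by (auto simp: doubleton_eq_iff)
  have ends: "hd (us @ y # y' # ws) \<in> B" "last (us @ y # y' # ws) \<in> B"
    using link_bd_iff_end[OF link] boundary.cycle_closed[OF bs_cycle c] by blast+
  then have "us \<noteq> []" "ws \<noteq> []" using y disjoint by auto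
  then have "\<exists>u \<in> set us. u \<in> B" "\<exists>w \<in> set ws. w \<in> B"
    using ends hd_in_set last_in_set
    by (metis hd_append2, metis last_ConsR last_append list.distinct(1))
  then obtain us' p us'' ws' q ws'' where
    us: "us = us' @ p # us''" "p \<in> B" "\<forall>u \<in> set us''. u \<notin> B" and
    ws: "ws = ws' @ q # ws''" "q \<in> B" "\<forall>w \<in> set ws'. w \<notin> B"
    using split_list_last_prop[of us "\<lambda>u. u \<in> B"] split_list_first_prop[of ws "\<lambda>w. w \<in> B"] by metis
  have "u \<in> A" if "u \<in> set (us'' @ y # y' # ws')" for u
  proof -
    have "E c u" using that link unfolding us(1) ws(1) link_def by auto
    then show ?thesis using that y us(3) ws(3) not_B_iff[of u] E_in_V2[of c u] by auto
  qed
  then show thesis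
    using that[of us' p "us'' @ y # y' # ws'" q ws''] link us(1,2) ws(1,2) by auto
qed

lemma wedge_exists:
  assumes c: "c \<in> B" and x: "x \<in> A" "x' \<in> A" "E c x" "E c x'" "E x x'"
    and rim: "\<And>u u'. \<lbrakk>u \<in> A; u' \<in> A; E c u; E c u'; E u u'\<rbrakk> \<Longrightarrow> bd u u'"
  obtains p q where "wedge c p q"
proof -
  obtain us p run q ws where link: "link E c (us @ p # run @ q # ws)" and pq: "p \<in> B" "q \<in> B"
    and run: "set run \<subseteq> A" "2 \<le> length run"
    using link_run_exists[OF c x] .
  have facing: "facing_chord c p"
    if link: "link E c (us @ p # run @ ws)" and p: "p \<in> B" and run: "set run \<subseteq> A" "2 \<le> length run"
    for us p run ws
  proof -
    obtain r r' rs where r: "run = r # r' # rs" using run(2) by (cases run; cases "tl run") auto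
    then have link': "link E c (us @ p # r # r' # rs @ ws)" using link by simp
    then have "E r r'" using link_adj_iff[of E c "us @ [p]" r "[]" r' "rs @ ws"] by simp
    moreover have "E c r" "E c r'" using link' unfolding link_def by auto
    ultimately have "bd r r'" using rim r run(1) by auto
    then show ?thesis using link_run_end[OF link' c p] r run(1) by auto
  qed
  have "link E c (rev ws @ q # rev run @ p # rev us)" using link_rev[OF link] by simp
  then have "facing_chord c p" "facing_chord c q"
    using facing[OF link pq(1) run] facing[of "rev ws" q "rev run" "p # rev us"] pq(2) run by auto
  moreover have "p \<noteq> q" "\<not> E p q"
    using link_adj_iff[OF link] run(2) link unfolding link_def by auto
  ultimately show thesis using that unfolding wedge_def by blast
qed

lemma transition_chord:
  assumes x: "x \<in> A" "x' \<in> A" "x'' \<in> A" "bd x x'" "bd x' x''"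
    and only: "\<And>z. \<lbrakk>z \<in> A; E x' z\<rbrakk> \<Longrightarrow> z = x \<or> z = x''"
    and c: "E x c" "E x' c" "E x' c'" "E x'' c'" "c \<noteq> c'" "c' \<in> B"
  obtains z where "z \<in> B" "chord c' z"
proof -
  obtain w w' where "w \<noteq> w'" "E x' w" "E c' w" "E x' w'" "E c' w'"
    using chord_common_neighbours[OF mixed_chord[OF x(2) c(6,3)]] .
  then obtain z where z: "z \<noteq> x''" "E x' z" "E c' z" by metis
  have "z \<noteq> x" using bd_apex_unique[OF x(4) c(1,2), of c'] z c E_sym by blast
  then have "z \<in> B" using only z not_B_iff E_in_V2 by metis
  moreover have "\<not> bd z c'" using rung_not_bd[OF x(2,3,5) \<open>z \<in> B\<close> c(6) z(2) c(4)] .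
  ultimately show thesis using that z(3) bd_sym unfolding chord_def by blast
qed

section \<open>Wedges in cycles of length at most 7\<close>

lemma wedge_sym: "wedge c p q \<Longrightarrow> wedge c q p"
  unfolding wedge_def using E_sym by blast

lemma facing_chord_ear_unique:
  assumes "facing_chord c p" "bd c y" "bd y p" "k \<in> B" "E c k" "E p k"
  shows "k = y"
proof -
  obtain a where "c \<in> B" "E c p" "a \<in> A" "E c a" "E p a"
    using assms(1) unfolding facing_chord_def chord_def by blast
  moreover from this have "y \<in> B" using boundary.cycle_closed[OF bs_cycle _ assms(2)] by blast
  ultimately show ?thesis
    using common_neighbours_le_2[of c p y k a] assms disjoint bd_E bd_sym by blast
qed

lemma wedge_cycle:
  assumes "wedge c p q"
  obtains us ws vs p' q' where "cyclic_list bd (c # us @ p' # ws @ q' # vs)"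
    "B = set (c # us @ p' # ws @ q' # vs)" "us \<noteq> []" "ws \<noteq> []" "vs \<noteq> []" "wedge c p' q'"
proof -
  have vertices: "c \<in> B" "p \<in> B" "q \<in> B" "c \<noteq> p" "c \<noteq> q" "p \<noteq> q"
    using assms E_irrefl unfolding wedge_def facing_chord_def chord_def by blast+
  obtain ys where ys: "cyclic_list bd (c # ys)" "set (c # ys) = B"
    using cyclic_list_start[OF bs_cycle vertices(1)] by metis
  have pq: "p \<in> set ys" "q \<in> set ys" using vertices ys(2) by auto
  obtain us p' zs where p': "ys = us @ p' # zs" "p' \<in> {p, q}" "\<forall>u \<in> set us. u \<notin> {p, q}"
    using split_list_first_prop[of ys "\<lambda>y. y \<in> {p, q}"] pq by blast
  define q' where "q' = (if p' = p then q else p)"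
  have wedge: "wedge c p' q'" using assms wedge_sym p'(2) unfolding q'_def by auto
  have "q' \<in> set zs" using p' pq vertices(6) unfolding q'_def by auto
  then obtain ws vs where "zs = ws @ q' # vs" by (metis split_list)
  then have cycle: "cyclic_list bd (c # us @ p' # ws @ q' # vs)"
    "B = set (c # us @ p' # ws @ q' # vs)" using ys p'(1) by auto
  have "\<not> bd c p'" "\<not> bd q' c" "\<not> bd p' q'"
    using wedge bd_E bd_sym unfolding wedge_def facing_chord_def chord_def by blast+
  then have "us \<noteq> []" "ws \<noteq> []" "vs \<noteq> []"
    using cycle(1) unfolding cyclic_list_def
    by (auto simp: successively_Cons successively_append_iff)
  then show thesis using that cycle wedge by blast
qed

lemma length_bs_eq:
  assumes "cyclic_list bd ys" "B = set ys"
  shows "length bs = length ys"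
  using assms bs_cycle distinct_card unfolding cyclic_list_def by metis

lemma wedge_6_cycle:
  assumes "wedge c p q" "length bs \<le> 6"
  obtains y1 p' y3 q' y5 where "cyclic_list bd [c, y1, p', y3, q', y5]"
    "B = set [c, y1, p', y3, q', y5]" "wedge c p' q'"
proof -
  obtain us ws vs p' q' where ys: "cyclic_list bd (c # us @ p' # ws @ q' # vs)"
    "B = set (c # us @ p' # ws @ q' # vs)" "us \<noteq> []" "ws \<noteq> []" "vs \<noteq> []" "wedge c p' q'"
    using wedge_cycle[OF assms(1)] .
  have "length us + length ws + length vs \<le> 3" using length_bs_eq[OF ys(1,2)] assms(2) by simp
  then obtain y1 y3 y5 where "us = [y1]" "ws = [y3]" "vs = [y5]"
    using ys(3-5) by (cases us; cases ws; cases vs) auto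
  then show thesis using that ys by auto
qed

text \<open>Up to reflection the gaps between \<open>c\<close>, \<open>p'\<close> and \<open>q'\<close> around \<open>B\<close> are 2, 3, 2 or 2, 2, 3.\<close>

lemma wedge_7_cycle:
  assumes "wedge c p q" "length bs = 7"
  obtains (symmetric) y1 p' y3 y4 q' y6 where "cyclic_list bd [c, y1, p', y3, y4, q', y6]"
      "B = set [c, y1, p', y3, y4, q', y6]" "wedge c p' q'"
    | (skew) y1 p' y3 q' y5 y6 where "cyclic_list bd [c, y1, p', y3, q', y5, y6]"
      "B = set [c, y1, p', y3, q', y5, y6]" "wedge c p' q'"
proof -
  obtain us ws vs p' q' where ys: "cyclic_list bd (c # us @ p' # ws @ q' # vs)"
    "B = set (c # us @ p' # ws @ q' # vs)" "us \<noteq> []" "ws \<noteq> []" "vs \<noteq> []" "wedge c p' q'"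
    using wedge_cycle[OF assms(1)] .
  have "length us + length ws + length vs = 4" using length_bs_eq[OF ys(1,2)] assms(2) by simp
  then consider (long_first) y1 y2 y4 y6 where "us = [y1, y2]" "ws = [y4]" "vs = [y6]"
    | (long_middle) y1 y3 y4 y6 where "us = [y1]" "ws = [y3, y4]" "vs = [y6]"
    | (long_last) y1 y3 y5 y6 where "us = [y1]" "ws = [y3]" "vs = [y5, y6]"
    using ys(3-5)
    by (cases us; cases "tl us"; cases ws; cases "tl ws"; cases vs; cases "tl vs") auto
  then show thesis
  proof cases
    case long_first
    then have "cyclic_list bd [c, y6, q', y4, p', y2, y1]" "B = set [c, y6, q', y4, p', y2, y1]"
      using ys(1,2) bd_sym unfolding cyclic_list_def by auto
    then show thesis using skew wedge_sym[OF ys(6)] by blast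
  next
    case long_middle
    then show thesis using symmetric ys by simp
  next
    case long_last
    then show thesis using skew ys by simp
  qed
qed

lemma wedge_6_chords:
  assumes wedge: "wedge c p q" and ys: "cyclic_list bd [c, y1, p, y3, q, y5]"
    "B = set [c, y1, p, y3, q, y5]" and chord: "u \<in> B" "v \<in> B" "chord u v"
  shows "{u, v} = {c, p} \<or> {u, v} = {c, q}"
proof -
  have edges: "bd c y1" "bd y1 p" "bd p y3" "bd y3 q" "bd q y5" "bd y5 c"
    and dist: "distinct [c, y1, p, y3, q, y5]" using ys(1) unfolding cyclic_list_def by auto
  have spokes: "facing_chord c p" "facing_chord c q" "E c p" "E c q" "\<not> E p q"
    using wedge unfolding wedge_def facing_chord_def chord_def by blast+
  have "\<not> chord c y3"
    using facing_chord_ear_unique[OF spokes(1) edges(1,2) _ _ bd_E[OF edges(3)]] dist ys(2)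
    unfolding chord_def by auto
  moreover have "\<not> chord p q" using spokes(5) unfolding chord_def by blast
  moreover have "w \<notin> {y1, y5}" if "chord w z" for w z
    using ear_no_chord[of y1 c p] ear_no_chord[of y5 q c] that edges bd_sym spokes E_sym by blast
  then have "u \<in> {c, p, y3, q}" "v \<in> {c, p, y3, q}"
    using chord chord_sym[OF chord(3)] ys(2) by auto
  ultimately show ?thesis
    using chord(3) chord_sym[OF chord(3)] edges(3,4)[THEN bd_not_chord] chord_irrefl
    by (elim insertE emptyE) (simp_all add: insert_commute)
qed

lemma wedge_7_symmetric_chords:
  assumes wedge: "wedge c p q" and ys: "cyclic_list bd [c, y1, p, y3, y4, q, y6]"
    "B = set [c, y1, p, y3, y4, q, y6]" and chord: "u \<in> B" "v \<in> B" "chord u v"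
  shows "{u, v} \<in> {{c, p}, {c, q}, {p, y4}, {q, y3}}"
proof -
  have edges: "bd c y1" "bd y1 p" "bd p y3" "bd y3 y4" "bd y4 q" "bd q y6" "bd y6 c"
    and dist: "distinct [c, y1, p, y3, y4, q, y6]" using ys(1) unfolding cyclic_list_def by auto
  have spokes: "facing_chord c p" "facing_chord c q" "E c p" "E c q" "\<not> E p q"
    using wedge unfolding wedge_def facing_chord_def chord_def by blast+
  have "\<not> chord p q" using spokes(5) unfolding chord_def by blast
  moreover have "\<not> chord c y3" "\<not> chord c y4"
    using facing_chord_ear_unique[OF spokes(1) edges(1,2) _ _ bd_E[OF edges(3)]]
      facing_chord_ear_unique[OF spokes(2) edges(7,6)[THEN bd_sym] _ _ bd_E[OF bd_sym[OF edges(5)]]]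
      dist ys(2)
    unfolding chord_def by auto
  moreover have "w \<notin> {y1, y6}" if "chord w z" for w z
    using ear_no_chord[of y1 c p] ear_no_chord[of y6 q c] that edges bd_sym spokes E_sym by blast
  then have "u \<in> {c, p, y3, y4, q}" "v \<in> {c, p, y3, y4, q}"
    using chord chord_sym[OF chord(3)] ys(2) by auto
  ultimately show ?thesis
    using chord(3) chord_sym[OF chord(3)] edges(3-5)[THEN bd_not_chord] chord_irrefl
    by (elim insertE emptyE) (simp_all add: insert_commute)
qed

lemma wedge_7_skew_chords:
  assumes wedge: "wedge c p q" and ys: "cyclic_list bd [c, y1, p, y3, q, y5, y6]"
    "B = set [c, y1, p, y3, q, y5, y6]" and chord: "u \<in> B" "v \<in> B" "chord u v"
  shows "{u, v} \<in> {{c, p}, {c, q}, {c, y5}, {p, y5}, {y3, y6}, {q, y6}}"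
proof -
  have edges: "bd c y1" "bd y1 p" "bd p y3" "bd y3 q" "bd q y5" "bd y5 y6" "bd y6 c"
    and dist: "distinct [c, y1, p, y3, q, y5, y6]" using ys(1) unfolding cyclic_list_def by auto
  have spokes: "facing_chord c p" "chord c q" "E c p" "\<not> E p q"
    using wedge unfolding wedge_def facing_chord_def chord_def by blast+
  have "\<not> chord p q" using spokes(4) unfolding chord_def by blast
  moreover have "\<not> chord c y3" "\<not> chord p y6"
    using facing_chord_ear_unique[OF spokes(1) edges(1,2) _ _ bd_E[OF edges(3)]]
      facing_chord_ear_unique[OF spokes(1) edges(1,2) _ bd_E[OF bd_sym[OF edges(7)]]] dist ys(2)
    unfolding chord_def by auto
  moreover have "\<not> chord y3 y5"
    using ear_no_chord(2)[of q y3 y5 c] spokes(2) edges(4,5) bd_sym unfolding chord_def by blast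
  moreover have "w \<noteq> y1" if "chord w z" for w z
    using ear_no_chord[of y1 c p] that edges bd_sym spokes by blast
  then have "u \<in> {c, p, y3, q, y5, y6}" "v \<in> {c, p, y3, q, y5, y6}"
    using chord chord_sym[OF chord(3)] ys(2) by auto
  ultimately show ?thesis
    using chord(3) chord_sym[OF chord(3)] edges(3-7)[THEN bd_not_chord] chord_irrefl
    by (elim insertE emptyE) (simp_all add: insert_commute)
qed

lemma wedge_unique:
  assumes "wedge c p q" "wedge c' p' q'" "length bs \<le> 6"
  shows "c' = c"
proof -
  obtain y1 r y3 s y5 where ys: "cyclic_list bd [c, y1, r, y3, s, y5]"
    "B = set [c, y1, r, y3, s, y5]" and wedge: "wedge c r s"
    using wedge_6_cycle[OF assms(1,3)] .
  have "{c', p'} = {c, r} \<or> {c', p'} = {c, s}" "{c', q'} = {c, r} \<or> {c', q'} = {c, s}" "p' \<noteq> q'"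
    using wedge_6_chords[OF wedge ys] assms(2) unfolding wedge_def facing_chord_def by blast+
  then show ?thesis using wedge unfolding wedge_def by (auto simp: doubleton_eq_iff)
qed

lemma wedge_6_no_chord:
  assumes wedge_c: "wedge c p q" "length bs \<le> 6" and g: "g \<in> B" "g \<noteq> c" "v \<in> B"
    and a: "a \<in> A" "E c a" "E g a" and a': "a' \<in> A" "E c a'" "E g a'" "a \<noteq> a'"
  shows "\<not> chord g v"
proof
  assume "chord g v"
  obtain y1 r y3 s y5 where ys: "cyclic_list bd [c, y1, r, y3, s, y5]"
    "B = set [c, y1, r, y3, s, y5]" and wedge: "wedge c r s"
    using wedge_6_cycle[OF wedge_c] .
  have "g = r \<or> g = s"
    using wedge_6_chords[OF wedge ys g(1,3) \<open>chord g v\<close>] g(2) by (auto simp: doubleton_eq_iff)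
  moreover have "bd c y1" "bd y1 r" "bd s y5" "bd y5 c" "y1 \<in> B" "y5 \<in> B"
    using ys unfolding cyclic_list_def by auto
  ultimately obtain y where "y \<in> B" "E c y" "E g y" using bd_E bd_sym by blast
  moreover have "E c g"
    using wedge \<open>g = r \<or> g = s\<close> unfolding wedge_def facing_chord_def chord_def by blast
  ultimately show False using common_neighbours_le_2[of c g a a' y] a a' disjoint by blast
qed

lemma wedge_pair:
  assumes wedges: "wedge c p q" "wedge c' p' q'" "c \<noteq> c'" and length: "length bs \<le> 7"
  obtains y where "bd c y" "bd y c'" "E c c'"
proof -
  have centre': "c' \<in> B" "p' \<in> B" "q' \<in> B" "chord c' p'" "chord c' q'" "p' \<noteq> q'" "\<not> E p' q'"
    using wedges(2) unfolding wedge_def facing_chord_def by blast+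
  have "length bs = 7" using wedge_unique[OF wedges(1,2)] wedges(3) length by fastforce
  with wedges(1) show thesis
  proof (cases rule: wedge_7_cycle)
    case (symmetric y1 r y3 y4 s y6)
    have edges: "bd c y1" "bd y1 r" "bd s y6" "bd y6 c"
      and dist: "distinct [c, y1, r, y3, y4, s, y6]"
      using symmetric(1) unfolding cyclic_list_def by auto
    have "E c r" "E c s" using symmetric(3) unfolding wedge_def facing_chord_def chord_def by blast+
    moreover have "c' = r \<or> c' = s"
      using wedge_7_symmetric_chords[OF symmetric(3,1,2) centre'(1,2,4)]
        wedge_7_symmetric_chords[OF symmetric(3,1,2) centre'(1,3,5)] wedges(3) centre'(6) dist
      by (auto simp: doubleton_eq_iff)
    ultimately show thesis using that edges bd_sym by blast
  next
    case (skew y1 r y3 s y5 y6)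
    have edges: "bd c y1" "bd y1 r" "bd y3 s" "bd y6 c"
      and dist: "distinct [c, y1, r, y3, s, y5, y6]"
      using skew(1) unfolding cyclic_list_def by auto
    have "E c r" using skew(3) unfolding wedge_def facing_chord_def chord_def by blast
    moreover from this have "c' = r"
      using wedge_7_skew_chords[OF skew(3,1,2) centre'(1,2,4)]
        wedge_7_skew_chords[OF skew(3,1,2) centre'(1,3,5)] wedges(3) centre'(6,7)
        edges dist bd_E E_sym
      by (auto simp: doubleton_eq_iff)
    ultimately show thesis using that edges by blast
  qed
qed

lemma wedge_no_three:
  assumes wedges: "wedge c p q" "wedge c' p' q'" "wedge c'' p'' q''" and length: "length bs \<le> 7"
  shows "c = c' \<or> c = c'' \<or> c' = c''"
proof (rule ccontr)
  assume "\<not> ?thesis"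
  then have neq: "c \<noteq> c'" "c' \<noteq> c''" "c'' \<noteq> c" by auto
  obtain y where y: "bd c y" "bd y c'" "E c c'" using wedge_pair[OF wedges(1,2) neq(1) length] .
  obtain y' where y': "bd c' y'" "bd y' c''" "E c' c''"
    using wedge_pair[OF wedges(2,3) neq(2) length] .
  obtain y'' where y'': "bd c'' y''" "bd y'' c" "E c'' c"
    using wedge_pair[OF wedges(3,1) neq(3) length] .
  have "y \<noteq> y'" "y' \<noteq> y''" "y'' \<noteq> y"
    using boundary.neighbours_le_2[of y c c' c''] boundary.neighbours_le_2[of y' c c' c'']
      y y' y'' neq bd_sym by blast+
  then have closed: "v \<in> {c, y, c', y', c'', y''}"
    if "u \<in> {c, y, c', y', c'', y''}" "bd u v" for u v
    using boundary.neighbours_le_2[of u _ _ v] that y y' y'' neq bd_sym by blast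
  have c: "c \<in> B" "p \<in> B" "q \<in> B" "chord c p" "chord c q" "p \<noteq> q" "\<not> E p q"
    using wedges(1) unfolding wedge_def facing_chord_def by blast+
  have "B \<subseteq> {c, y, c', y', c'', y''}"
    by (rule boundary.cycle_subset[OF bs_cycle c(1)]) (use closed in auto)
  moreover have "z \<notin> {c, y, y', y''}" if "chord c z" for z
    using that ear_no_chord[of y c c'] ear_no_chord[of y' c' c''] ear_no_chord[of y'' c'' c]
      y y' y'' bd_sym E_irrefl unfolding chord_def by blast
  ultimately have "p \<in> {c', c''}" "q \<in> {c', c''}" using c by blast+
  then show False using c(6,7) y'(3) E_sym by auto
qed

lemma wedge_pair_common_neighbour:
  assumes wedges: "wedge c p q" "wedge c' p' q'" "c \<noteq> c'" and length: "length bs \<le> 7"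
    and a: "a \<in> A" "E c a" "E c' a" and a': "a' \<in> A" "E c a'" "E c' a'"
  shows "a = a'"
proof -
  obtain y where y: "bd c y" "bd y c'" "E c c'" using wedge_pair[OF wedges length] .
  have "c \<in> B" using wedges(1) unfolding wedge_def facing_chord_def by blast
  then have "y \<in> B" using boundary.cycle_closed[OF bs_cycle] y(1) by blast
  then show ?thesis
    using common_neighbours_le_2[of c c' a a' y] y a a' disjoint bd_E bd_sym by blast
qed

section \<open>A chordless boundary cycle\<close>

lemma chordless_apex_wedge:
  assumes "chordless A" and x: "x \<in> A" "x' \<in> A" "bd x x'"
  obtains c p q where "E x c" "E x' c" "wedge c p q"
proof -
  have bd: "bd u u'" if "u \<in> A" "u' \<in> A" "E u u'" for u u'
    using assms(1) that unfolding chordless_def chord_def by blast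
  obtain c where c: "E x c" "E x' c" using bd_apex[OF x(3)] by blast
  have "c \<in> B"
  proof (rule ccontr)
    assume "c \<notin> B"
    then have "c \<in> A" using not_B_iff E_in_V2 c(1) by blast
    then have "bd x' c" "bd c x" using bd c x(1,2) E_sym by blast+
    moreover from this have "distinct [x, x', c]" using x(3) bd_E E_irrefl by fastforce
    ultimately have "cyclic_list bd [x, x', c]" using x(3) unfolding cyclic_list_def by simp
    then have "set [x, x', c] = V" using bd_cycle_length by fastforce
    then show False using x(1,2) \<open>c \<in> A\<close> A_proper by auto
  qed
  then obtain p q where "wedge c p q"
    using wedge_exists[OF _ x(1,2) E_sym[OF c(1)] E_sym[OF c(2)] bd_E[OF x(3)]] bd by blast
  then show thesis using that c by blast
qed

lemma chordless_bound:
  assumes "chordless A"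
  shows "8 \<le> length bs"
proof (rule ccontr)
  assume "\<not> ?thesis"
  then have length: "length bs \<le> 7" by simp
  have "\<exists>c. E x c \<and> E y c \<and> (\<exists>p q. wedge c p q)" if "x \<in> A" "y \<in> A" "bd x y" for x y
    using chordless_apex_wedge[OF assms that] by metis
  then obtain f where f: "\<And>x y. \<lbrakk>x \<in> A; y \<in> A; bd x y\<rbrakk> \<Longrightarrow>
    E x (f x y) \<and> E y (f x y) \<and> (\<exists>p q. wedge (f x y) p q)" by metis
  from as_cycle show False
  proof (cases rule: cyclic_list_label_cases[where f = f])
    case (uniform c)
    have "cyclic_list E as" using as_cycle by (rule cyclic_list_mono) (rule bd_E)
    moreover have "\<forall>x \<in> A. E c x" using uniform f E_sym by blast
    ultimately show ?thesis using link_acyclic by blast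
  next
    case (changing x y z x' y' z')
    have apex: "E x (f x y) \<and> E y (f x y)" "E y (f y z) \<and> E z (f y z)"
      "E x' (f x' y') \<and> E y' (f x' y')" "E y' (f y' z') \<and> E z' (f y' z')"
      using f changing by auto
    obtain p q p' q' where wedges: "wedge (f x y) p q" "wedge (f y z) p' q'"
      using f changing by (metis insert_subset)
    have two_centres: "c = f x y \<or> c = f y z" if "wedge c r s" for c r s
      using wedge_no_three[OF wedges that length] changing(5) by metis
    have "\<exists>p q. wedge (f x' y') p q" "\<exists>p q. wedge (f y' z') p q" using f changing by auto
    then have "f x' y' \<in> {f x y, f y z}" "f y' z' \<in> {f x y, f y z}" using two_centres by blast+
    then have "{f x' y', f y' z'} = {f x y, f y z}" using changing(8) by auto
    then have "E (f x y) y'" "E (f y z) y'"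
      using apex(3,4) E_sym by (metis doubleton_eq_iff)+
    then have "y = y'"
      using wedge_pair_common_neighbour[OF wedges changing(5) length] apex(1,2) changing(2) E_sym
      by auto
    then show ?thesis using changing(1) by blast
  qed
qed

end

section \<open>Short boundary cycles with chords\<close>

locale eared_pentagon = two_boundary_cycles +
  fixes e d0 d1 d2 d3 :: 'a
  assumes pentagon: "cyclic_list bd [e, d0, d1, d2, d3]" and A_eq: "A = set [e, d0, d1, d2, d3]"
    and diagonal: "E d0 d3"
begin

lemma sides: "bd e d0" "bd d0 d1" "bd d1 d2" "bd d2 d3" "bd d3 e"
  and corners: "distinct [e, d0, d1, d2, d3]"
  using pentagon unfolding cyclic_list_def by auto

lemma not_bd_diagonal: "\<not> bd d0 d3"
  using boundary.neighbours_le_2[of d0 e d1 d3] sides corners bd_sym by auto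

lemma other_diagonals: "\<not> E d0 d2" "\<not> E d1 d3" "\<not> E e d1" "\<not> E e d2"
proof -
  have "cyclic_list bd [d0, d1, d2, d3, e]" "A = set [d0, d1, d2, d3, e]"
    "cyclic_list bd [d3, d2, d1, d0, e]" "A = set [d3, d2, d1, d0, e]"
    using sides[THEN bd_sym] sides corners A_eq unfolding cyclic_list_def by auto
  moreover have "E d0 d1" "E d0 e" "E d3 d2" "E d3 e" "E d3 d0"
    using sides bd_E diagonal E_sym by blast+
  ultimately show "\<not> E d0 d2" "\<not> E d1 d3"
    using bd_cycle_fan_covers[of d0 "[d1, d2, d3, e]"]
      bd_cycle_fan_covers[of d3 "[d2, d1, d0, e]"] diagonal E_sym A_proper by auto
  show "\<not> E e d1" "\<not> E e d2"
    using ear_neighbours[OF bd_sym[OF sides(5)] sides(1) E_sym[OF diagonal]] corners by auto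
qed

lemma core_neighbours:
  assumes "z \<in> A"
  shows "E d0 z \<longleftrightarrow> z \<in> {e, d1, d3}" "E d1 z \<longleftrightarrow> z \<in> {d0, d2}"
    "E d2 z \<longleftrightarrow> z \<in> {d1, d3}" "E d3 z \<longleftrightarrow> z \<in> {e, d0, d2}"
  using assms other_diagonals other_diagonals[THEN contrapos_nn, OF E_sym]
    diagonal E_sym[OF diagonal] sides[THEN bd_E] sides[THEN bd_E, THEN E_sym] E_irrefl unfolding A_eq by auto

lemma bd_or_diagonal:
  assumes "x \<in> A" "y \<in> A" "E x y"
  shows "bd x y \<or> {x, y} = {d0, d3}"
proof -
  have "E x y" "E y x" using assms(3) E_sym by blast+
  then show ?thesis
    using assms(1,2) core_neighbours[of x] core_neighbours[of y] sides sides[THEN bd_sym] E_irrefl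
    unfolding A_eq by auto
qed

abbreviation "core \<equiv> [d0, d1, d2, d3]"

lemma core_apex_exists:
  assumes x: "x \<in> set core" "y \<in> set core" "E x y"
  shows "\<exists>c \<in> B. E x c \<and> E y c"
proof -
  have in_A: "x \<in> A" "y \<in> A" "E y x" using x E_sym unfolding A_eq by auto
  have "c \<in> B \<or> c = e \<and> {x, y} = {d0, d3}" if "E x c" "E y c" for c
  proof (cases "c \<in> B")
    case False
    then have "c \<in> A" using that not_B_iff E_in_V2 by blast
    then show ?thesis
      using that x in_A core_neighbours[OF \<open>c \<in> A\<close>] core_neighbours[OF in_A(1)]
        core_neighbours[OF in_A(2)] corners by auto
  qed simp
  moreover obtain c where "E x c" "E y c" "c \<noteq> e \<or> {x, y} \<noteq> {d0, d3}"
  proof (cases "{x, y} = {d0, d3}")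
    case True
    then have "chord x y" using x(3) not_bd_diagonal bd_sym unfolding chord_def
      by (auto simp: doubleton_eq_iff)
    then show thesis using chord_common_neighbours that by metis
  next
    case False
    then show thesis using common_neighbour_exists[OF x(3)] that by metis
  qed
  ultimately show ?thesis by blast
qed

lemma core_cycle: "cyclic_list E core"
  using sides[THEN bd_E] corners E_sym[OF diagonal] unfolding cyclic_list_def by auto

lemma diagonal_apex_unique:
  assumes "c \<in> B" "E d0 c" "E d3 c" "c' \<in> B" "E d0 c'" "E d3 c'"
  shows "c = c'"
  using common_neighbours_le_2[OF diagonal, of e c c'] assms sides[THEN bd_E] E_sym A_eq disjoint
  by auto

lemma side_apex_wedge:
  assumes x: "x \<in> A" "y \<in> A" "E x y" and c: "c \<in> B" "E x c" "E y c" "\<not> (E d0 c \<and> E d3 c)"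
  obtains p q where "wedge c p q"
proof (rule wedge_exists[OF c(1) x(1,2) E_sym[OF c(2)] E_sym[OF c(3)] x(3)])
  fix u u' assume "u \<in> A" "u' \<in> A" "E c u" "E c u'" "E u u'"
  moreover have "\<not> (E c d0 \<and> E c d3)" using c(4) E_sym by blast
  ultimately show "bd u u'" using bd_or_diagonal by (metis doubleton_eq_iff)
qed (use that in blast)

lemma core_transition_chord:
  assumes "(x, y, z) \<in> {(d0, d1, d2), (d2, d1, d0), (d1, d2, d3), (d3, d2, d1)}"
    and "E x c" "E y c" "E y g" "E z g" "c \<noteq> g" "g \<in> B"
  obtains v where "v \<in> B" "chord g v"
proof (rule transition_chord[of x y z c g])
  show "x \<in> A" "y \<in> A" "z \<in> A" using assms(1) A_eq by auto
  show "bd x y" "bd y z" using assms(1) sides sides[THEN bd_sym] by auto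
  show "w = x \<or> w = z" if "w \<in> A" "E y w" for w
    using assms(1) core_neighbours[OF that(1)] that(2) by auto
qed (use assms that in blast)+

lemma core_two_apexes_chord:
  assumes f: "\<And>x y. \<lbrakk>x \<in> set core; y \<in> set core; E x y\<rbrakk> \<Longrightarrow>
      E x (f x y) \<and> E y (f x y) \<and> (f x y = c \<or> f x y = g)"
    and g: "c \<noteq> g" "g \<in> B"
  obtains v where "v \<in> B" "chord g v"
proof -
  have "E d0 d1" "E d1 d2" "E d2 d3" using sides bd_E by blast+
  then have apex: "E d0 (f d0 d1)" "E d1 (f d0 d1)" "E d1 (f d1 d2)" "E d2 (f d1 d2)"
    "E d2 (f d2 d3)" "E d3 (f d2 d3)"
    and two_valued: "f d0 d1 \<in> {c, g}" "f d1 d2 \<in> {c, g}" "f d2 d3 \<in> {c, g}" using f by auto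
  have "\<not> (f d0 d1 = f d1 d2 \<and> f d1 d2 = f d2 d3)"
    using link_acyclic[OF core_cycle, of "f d0 d1"] apex E_sym by auto
  then consider "f d0 d1 = c" "f d1 d2 = g" | "f d0 d1 = g" "f d1 d2 = c"
    | "f d1 d2 = c" "f d2 d3 = g" | "f d1 d2 = g" "f d2 d3 = c" using two_valued by auto
  then show thesis
    using core_transition_chord[of _ _ _ c g] apex g that by cases (metis insert_iff)+
qed

lemma length_bs_ge_7: "7 \<le> length bs"
proof (rule ccontr)
  assume "\<not> ?thesis"
  then have length: "length bs \<le> 6" by simp
  obtain f where f: "\<And>x y. \<lbrakk>x \<in> set core; y \<in> set core; E x y\<rbrakk> \<Longrightarrow>
    f x y \<in> B \<and> E x (f x y) \<and> E y (f x y)" using core_apex_exists by metis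
  define g where "g = f d0 d3"
  have g: "g \<in> B" "E d0 g" "E d3 g" using f[of d0 d3] diagonal unfolding g_def by auto
  have wedge: "\<exists>p q. wedge (f x y) p q"
    if x: "x \<in> set core" "y \<in> set core" "E x y" "f x y \<noteq> g" for x y
  proof -
    have "x \<in> A" "y \<in> A" using x A_eq by auto
    then show ?thesis
      using side_apex_wedge[OF _ _ x(3)] diagonal_apex_unique[OF _ _ _ g] f[OF x(1-3)] x(4) by metis
  qed
  from core_cycle show False
  proof (cases rule: cyclic_list_label_cases[where f = f])
    case (uniform c)
    then show ?thesis using link_acyclic[OF core_cycle, of c] f E_sym by blast
  next
    case (changing x y z x' y' z')
    have "f x y \<noteq> g \<or> f y z \<noteq> g" using changing(5) by metis
    then obtain c p q where c: "wedge c p q" "c \<noteq> g"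
      using wedge changing(2-4) by (metis insert_subset)
    have two_valued: "f x y = c \<or> f x y = g" if "x \<in> set core" "y \<in> set core" "E x y" for x y
      using wedge[OF that] wedge_unique[OF c(1) _ length] by blast
    then obtain v where v: "v \<in> B" "chord g v"
      using core_two_apexes_chord[of f c g] f c(2) g(1) by metis
    have both: "E c y \<and> E g y"
      if "{x, y, z} \<subseteq> set core" "E x y" "E y z" "f x y \<noteq> f y z" for x y z
      using two_valued[of x y] two_valued[of y z] f[of x y] f[of y z] that E_sym
      by (metis insert_subset)
    have "y \<in> A" "y' \<in> A" "E c y" "E g y" "E c y'" "E g y'"
      using both[of x y z] both[of x' y' z'] changing A_eq by auto
    then show ?thesis
      using wedge_6_no_chord[OF c(1) length g(1) _ v(1)] c(2) changing(1) v(2) by metis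
  qed
qed

end

context two_boundary_cycles
begin

lemma chordless_4_cycle:
  assumes "length as = 4"
  shows "chordless A"
  unfolding chordless_def
proof (intro ballI notI)
  fix x x' assume x: "x \<in> A" "x' \<in> A" "chord x x'"
  obtain ys where ys: "cyclic_list bd (x # ys)" "set (x # ys) = A" "length (x # ys) = 4"
    using cyclic_list_start[OF as_cycle x(1)] assms by metis
  then obtain y1 y2 y3 where [simp]: "ys = [y1, y2, y3]"
    by (auto simp: numeral_eq_Suc length_Suc_conv)
  have sides: "bd x y1" "bd y3 x" using ys(1) unfolding cyclic_list_def by auto
  then have "x' = y2" using x ys(2) bd_not_chord chord_irrefl by fastforce
  then have "E x y" if "y \<in> set ys" for y
    using that sides x(3) bd_E E_sym unfolding chord_def by auto
  then show False using bd_cycle_fan_covers[OF ys(1)] ys(2) A_proper by blast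
qed

lemma eared_pentagon_exists:
  assumes "length as = 5" "\<not> chordless A"
  obtains e d0 d1 d2 d3 where "eared_pentagon V E as bs e d0 d1 d2 d3"
proof -
  obtain x x' where x: "x \<in> A" "x' \<in> A" "chord x x'" using assms(2) unfolding chordless_def by blast
  obtain ys where ys: "cyclic_list bd (x # ys)" "set (x # ys) = A" "length (x # ys) = 5"
    using cyclic_list_start[OF as_cycle x(1)] assms(1) by metis
  then obtain y1 y2 y3 y4 where [simp]: "ys = [y1, y2, y3, y4]"
    by (auto simp: numeral_eq_Suc length_Suc_conv)
  have "bd x y1" "bd y4 x" using ys(1) unfolding cyclic_list_def by auto
  then have "x' = y2 \<or> x' = y3" using x ys(2) bd_not_chord chord_irrefl by fastforce
  then show thesis
  proof
    assume "x' = y2"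
    then have "E y2 x" using x(3) E_sym unfolding chord_def by blast
    moreover have "cyclic_list bd [y1, y2, y3, y4, x]" "A = set [y1, y2, y3, y4, x]"
      using cyclic_list_append_commute[of bd "[x]" ys] ys(1,2) by auto
    ultimately have "eared_pentagon V E as bs y1 y2 y3 y4 x"
      by (intro eared_pentagon.intro two_boundary_cycles_axioms eared_pentagon_axioms.intro)
    then show thesis by (rule that)
  next
    assume "x' = y3"
    then have "E x y3" using x(3) unfolding chord_def by blast
    moreover have "cyclic_list bd [y4, x, y1, y2, y3]" "A = set [y4, x, y1, y2, y3]"
      using cyclic_list_append_commute[of bd "[x, y1, y2, y3]" "[y4]"] ys(1,2) by auto
    ultimately have "eared_pentagon V E as bs y4 x y1 y2 y3"
      by (intro eared_pentagon.intro two_boundary_cycles_axioms eared_pentagon_axioms.intro)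
    then show thesis by (rule that)
  qed
qed

lemma two_cycles_bound:
  assumes "length as \<le> length bs"
  shows "12 \<le> length as + length bs"
proof (cases "chordless A")
  case True
  then show ?thesis using chordless_bound bd_cycle_length[OF as_cycle] A_proper by fastforce
next
  case False
  have "4 \<le> length as" using bd_cycle_length[OF as_cycle] A_proper by blast
  moreover have "length as \<noteq> 4" using chordless_4_cycle False by blast
  moreover have "7 \<le> length bs" if "length as = 5"
    using eared_pentagon_exists[OF that False] eared_pentagon.length_bs_ge_7 by metis
  ultimately show ?thesis using assms by (cases "length as = 5") auto
qed

end

section \<open>The lower bound\<close>

context locally_linear_graph
begin

lemma two_cycles_cover_bound:
  assumes xs: "cyclic_list bd xs" and ys: "cyclic_list bd ys"
    and disjoint: "set xs \<inter> set ys = {}" and cover: "set xs \<union> set ys = V"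
    and nonham: "\<nexists>zs. cyclic_list E zs \<and> set zs = V"
  shows "12 \<le> card V"
proof -
  have "ladder_free (set xs) (set ys)"
    using ladder_hamiltonian[OF xs ys disjoint] nonham cover by metis
  then have "two_boundary_cycles V E xs ys" "two_boundary_cycles V E ys xs"
    using xs ys disjoint cover ladder_free_sym by (unfold_locales; blast)+
  then have "12 \<le> length xs + length ys"
    using two_boundary_cycles.two_cycles_bound by (metis add.commute nat_le_linear)
  also have "\<dots> = card V"
    using xs ys disjoint cover unfolding cyclic_list_def
    by (metis List.finite_set card_Un_disjoint distinct_card)
  finally show ?thesis .
qed

theorem nonhamiltonian_card_bound:
  assumes nonham: "\<nexists>zs. cyclic_list E zs \<and> set zs = V"
  shows "12 \<le> card V"
proof -
  have not_V: "set xs \<noteq> V" if "cyclic_list bd xs" for xs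
    using nonham cyclic_list_mono[OF that] bd_E by metis
  have card: "4 \<le> card (set xs)" if "cyclic_list bd xs" for xs
    using bd_cycle_length[OF that not_V[OF that]] that distinct_card
    unfolding cyclic_list_def by metis
  obtain v where "v \<in> V" using card_V by fastforce
  then obtain xs where xs: "cyclic_list bd xs" "set xs \<subseteq> V" using boundary.cycle_exists by metis
  then obtain w where "w \<in> V" "w \<notin> set xs" using not_V by blast
  then obtain ys where ys: "cyclic_list bd ys" "set ys \<subseteq> V" "set xs \<inter> set ys = {}"
    using boundary.cycle_exists boundary.cycles_disjoint[OF xs(1)] by metis
  show ?thesis
  proof (cases "set xs \<union> set ys = V")
    case True
    then show ?thesis using two_cycles_cover_bound xs(1) ys(1,3) nonham by blast
  next
    case False
    then obtain u where u: "u \<in> V" "u \<notin> set xs" "u \<notin> set ys" using xs(2) ys(2) by blast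
    then obtain zs where zs: "cyclic_list bd zs" "set zs \<subseteq> V"
      "set xs \<inter> set zs = {}" "set ys \<inter> set zs = {}"
      using boundary.cycle_exists[OF u(1)] boundary.cycles_disjoint[OF xs(1) _ _ u(2)]
        boundary.cycles_disjoint[OF ys(1) _ _ u(3)] by metis
    have "card (set xs \<union> set ys \<union> set zs) = card (set xs) + card (set ys) + card (set zs)"
      using ys(3) zs(3,4) by (simp add: card_Un_disjoint Int_Un_distrib2)
    moreover have "card (set xs \<union> set ys \<union> set zs) \<le> card V"
      using xs(2) ys(2) zs(2) finite_V by (intro card_mono) auto
    ultimately show ?thesis using card[OF xs(1)] card[OF ys(1)] card[OF zs(1)] by linarith
  qed
qed

end

section \<open>Digraphs as relations\<close>

abbreviation arc_rel :: "'a pair_pre_digraph \<Rightarrow> 'a \<Rightarrow> 'a \<Rightarrow> bool" where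
  "arc_rel G u v \<equiv> (u, v) \<in> parcs G"

lemma pcas_zip: "pcas x (zip (x # ys) (ys @ [z])) z"
  by (induction ys arbitrary: x) auto

lemma tl_pawalk_verts:
  assumes "pcas u p v"
  shows "tl (pawalk_verts u p) = map snd p"
  using assms
proof (induction p arbitrary: u)
  case (Cons e p)
  then show ?case by (cases p) auto
qed simp

lemma hamiltonianI:
  assumes "pair_graph G" and xs: "cyclic_list (arc_rel G) xs" "set xs = pverts G"
  shows "hamiltonian (with_proj G)"
proof -
  interpret pair_graph G by fact
  define p where "p = zip xs (rotate1 xs)"
  have p: "map fst p = xs" "map snd p = rotate1 xs" "length p = length xs"
    unfolding p_def by simp_all
  have length: "3 \<le> length xs" and dist: "distinct xs" using xs(1) unfolding cyclic_list_def by auto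
  then obtain x ys where "xs = x # ys" by (cases xs) auto
  then have cas: "pcas x p x" and x: "x \<in> pverts G"
    using pcas_zip[of x ys x] xs(2) unfolding p_def by auto
  have "set p \<subseteq> parcs G"
  proof
    fix e assume "e \<in> set p"
    then obtain i where i: "i < length xs" "e = (xs ! i, rotate1 xs ! i)"
      unfolding p_def by (auto simp: set_zip)
    then show "e \<in> parcs G"
      using cyclic_list_nth_mod[OF xs(1), of i] by (simp add: nth_rotate1)
  qed
  then have "awalk x p x" using cas x unfolding awalk_def by simp
  moreover have "distinct (tl (pawalk_verts x p))"
    unfolding tl_pawalk_verts[OF cas] p(2) using dist by simp
  moreover have "p \<noteq> []" using length p(3) by auto
  ultimately have "cycle p" unfolding cycle_def by auto
  moreover have "fst ` set p = pverts G" using p(1) xs(2) by (metis list.set_map)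
  ultimately show ?thesis unfolding hamiltonian_def using length p(3) by auto
qed

lemma connected_edge_out:
  assumes "pair_graph G" "Digraph_Component.connected (with_proj G)"
    and S: "S \<subseteq> pverts G" "S \<noteq> {}" "S \<noteq> pverts G"
  shows "\<exists>u \<in> S. \<exists>w \<in> pverts G - S. (u, w) \<in> parcs G"
proof (rule ccontr)
  assume closed: "\<not> ?thesis"
  interpret pair_graph G by fact
  obtain u v where uv: "u \<in> S" "v \<in> pverts G" "v \<notin> S" using S by blast
  then have "u \<rightarrow>\<^sup>*\<^bsub>with_proj (mk_symmetric (with_proj G))\<^esub> v"
    using assms(2) S(1) unfolding Digraph_Component.connected_def strongly_connected_def by auto
  then have "u \<rightarrow>\<^sup>*\<^bsub>with_proj G\<^esub> v" using reachable_mk_symmetric_eq sym_arcs by blast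
  then have "v \<in> S" using uv(1)
  proof (induction rule: reachable_induct)
    case (step x y)
    then have "(x, y) \<in> parcs G" by simp
    then show ?case using closed step in_arcsD2 by blast
  qed simp
  then show False using uv by blast
qed

lemma connected_if_traceable:
  assumes "pair_graph G" and xs: "xs \<noteq> []" "successively (arc_rel G) xs" "set xs = pverts G"
  shows "Digraph_Component.connected (with_proj G)"
proof -
  interpret pair_graph G by fact
  define x where "x = hd xs"
  have "x \<in> pverts G" unfolding x_def xs(3)[symmetric] using xs(1) by (rule hd_in_set)
  then have "set xs \<subseteq> {v. x \<rightarrow>\<^sup>*\<^bsub>with_proj G\<^esub> v}"
    using xs(1,2) reachable_adj_trans[of x]
    by (intro successively_subset[of "arc_rel G"]) (auto simp: x_def)
  then have "u \<rightarrow>\<^sup>*\<^bsub>with_proj G\<^esub> v" if "u \<in> pverts G" "v \<in> pverts G" for u v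
    using that xs(3) symmetric_reachable[OF sym_arcs] reachable_trans by blast
  then have "u \<rightarrow>\<^sup>*\<^bsub>with_proj (mk_symmetric (with_proj G))\<^esub> v"
    if "u \<in> pverts G" "v \<in> pverts G" for u v
    using that reachable_mk_symmetricI by blast
  then show ?thesis
    unfolding Digraph_Component.connected_def strongly_connected_def
    using \<open>x \<in> pverts G\<close> by auto
qed

lemma arcs_ends_induced_path_iff:
  assumes "distinct xs" "set xs = S"
  shows "arcs_ends (with_proj G \<restriction> S) = {(xs ! i, xs ! j) | i j.
      i < length xs \<and> j < length xs \<and> (j = Suc i \<or> i = Suc j)} \<longleftrightarrow>
    (\<forall>i < length xs. \<forall>j < length xs. arc_rel G (xs ! i) (xs ! j) \<longleftrightarrow> j = Suc i \<or> i = Suc j)"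
    (is "?ends = ?path \<longleftrightarrow> ?consecutive")
proof
  have ends: "?ends = {e \<in> parcs G. fst e \<in> set xs \<and> snd e \<in> set xs}"
    unfolding assms(2) by (auto simp: arcs_ends_conv)
  have path: "(xs ! i, xs ! j) \<in> ?path \<longleftrightarrow> j = Suc i \<or> i = Suc j"
    if "i < length xs" "j < length xs" for i j
    using that assms(1) by (auto simp: nth_eq_iff_index_eq)
  show ?consecutive if "?ends = ?path"
  proof (intro allI impI)
    fix i j assume ij: "i < length xs" "j < length xs"
    then have "(xs ! i, xs ! j) \<in> ?ends \<longleftrightarrow> arc_rel G (xs ! i) (xs ! j)" unfolding ends by simp
    then show "arc_rel G (xs ! i) (xs ! j) \<longleftrightarrow> j = Suc i \<or> i = Suc j"
      unfolding \<open>?ends = ?path\<close> path[OF ij] by simp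
  qed
  show "?ends = ?path" if ?consecutive
  proof (intro equalityI subsetI)
    fix e assume e: "e \<in> ?ends"
    then obtain i j where "e = (xs ! i, xs ! j)" "i < length xs" "j < length xs"
      unfolding ends by (cases e) (auto simp: in_set_conv_nth)
    then show "e \<in> ?path" using e \<open>?consecutive\<close> unfolding ends by blast
  next
    fix e assume "e \<in> ?path"
    then show "e \<in> ?ends" using \<open>?consecutive\<close> unfolding ends by force
  qed
qed

lemma path_graph_neighbourhood_iff:
  "path_graph (with_proj G \<restriction> neighbourhood (with_proj G) v) \<longleftrightarrow> (\<exists>xs. link (arc_rel G) v xs)"
proof -
  have N: "neighbourhood (with_proj G) v = {u. arc_rel G v u}" unfolding neighbourhood_def by simp
  show ?thesis
    unfolding path_graph_def link_def N induce_subgraph_verts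
    by (intro ex_cong1 conj_cong refl eq_commute arcs_ends_induced_path_iff)
qed

lemma locally_linear_iff:
  "locally_linear (with_proj G) \<longleftrightarrow> (\<forall>v \<in> pverts G. \<exists>xs. link (arc_rel G) v xs)"
  unfolding locally_linear_def path_graph_neighbourhood_iff by simp

lemma locally_linear_graph_digraph:
  assumes G: "pair_graph G" "Digraph_Component.connected (with_proj G)"
    "locally_linear (with_proj G)" "3 \<le> card (pverts G)"
  shows "locally_linear_graph (pverts G) (arc_rel G)"
proof -
  interpret pair_graph G by fact
  show ?thesis
  proof
    show "finite (pverts G)" by (rule pair_finite_verts)
    show "3 \<le> card (pverts G)" by (rule G(4))
    show "\<exists>xs. link (arc_rel G) v xs" if "v \<in> pverts G" for v
      using G(3) that unfolding locally_linear_iff by blast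
    show "\<exists>u \<in> S. \<exists>w \<in> pverts G - S. arc_rel G u w"
      if "S \<subseteq> pverts G" "S \<noteq> {}" "S \<noteq> pverts G" for S
      using connected_edge_out[OF G(1,2) that] .
  qed (use in_arcsD1 arcs_symmetric no_loops' in blast)+
qed

section \<open>The extremal graph\<close>

text \<open>Vertices 0 to 3 form the inner cycle, 4 to 7 the ring, and 8 to 11 have degree 2.\<close>

definition sun_edges :: "(nat \<times> nat) list" where
  "sun_edges =
    [(0, 1), (1, 2), (2, 3), (3, 0),
     (4, 5), (5, 6), (6, 7), (7, 4),
     (0, 4), (0, 5), (1, 5), (1, 6), (2, 6), (2, 7), (3, 7), (3, 4),
     (8, 4), (8, 5), (9, 5), (9, 6), (10, 6), (10, 7), (11, 7), (11, 4)]"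

definition sun_arcs :: "(nat \<times> nat) list" where
  "sun_arcs = sun_edges @ map prod.swap sun_edges"

definition sun_graph :: "nat pair_pre_digraph" where
  "sun_graph = \<lparr>pverts = {..<12}, parcs = set sun_arcs\<rparr>"

definition sun_link :: "nat \<Rightarrow> nat list" where
  "sun_link v =
    [[3, 4, 5, 1], [0, 5, 6, 2], [1, 6, 7, 3], [2, 7, 4, 0],
     [11, 7, 3, 0, 5, 8], [8, 4, 0, 1, 6, 9], [9, 5, 1, 2, 7, 10], [10, 6, 2, 3, 4, 11],
     [4, 5], [5, 6], [6, 7], [7, 4]] ! v"

lemma sun_graph_simps:
  "pverts sun_graph = {..<12}" "parcs sun_graph = set sun_arcs"
  unfolding sun_graph_def by simp_all

lemma sun_pair_graph: "pair_graph sun_graph"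
proof
  have "\<forall>e \<in> set sun_arcs. fst e < 12 \<and> snd e < 12 \<and> fst e \<noteq> snd e"
    unfolding sun_arcs_def sun_edges_def by simp
  then show "fst e \<in> pverts sun_graph" "snd e \<in> pverts sun_graph" "fst e \<noteq> snd e"
    if "e \<in> parcs sun_graph" for e
    using that unfolding sun_graph_simps by auto
  have "(v, u) \<in> set sun_arcs" if "(u, v) \<in> set sun_arcs" for u v
    using that unfolding sun_arcs_def by auto
  then show "symmetric (with_proj sun_graph)"
    unfolding symmetric_def by (auto simp: sun_graph_simps intro: symI)
qed (auto simp: sun_graph_simps)

lemma sun_graph_link:
  assumes "v < 12"
  shows "link (arc_rel sun_graph) v (sun_link v)"
proof -
  have "\<forall>v \<in> set [0..<12]. sun_link v \<noteq> [] \<and> distinct (sun_link v) \<and>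
    set (sun_link v) = set (map snd (filter (\<lambda>e. fst e = v) sun_arcs)) \<and>
    (\<forall>i \<in> set [0..<length (sun_link v)]. \<forall>j \<in> set [0..<length (sun_link v)].
      (sun_link v ! i, sun_link v ! j) \<in> set sun_arcs \<longleftrightarrow> j = Suc i \<or> i = Suc j)"
    by code_simp
  moreover have "set (map snd (filter (\<lambda>e. fst e = v) sun_arcs)) = {u. arc_rel sun_graph v u}"
    unfolding sun_graph_simps by force
  ultimately show ?thesis using assms unfolding link_def sun_graph_simps by simp
qed

lemma sun_locally_linear: "locally_linear (with_proj sun_graph)"
  unfolding locally_linear_iff using sun_graph_link by (auto simp: sun_graph_simps)

lemma sun_connected: "Digraph_Component.connected (with_proj sun_graph)"
proof (rule connected_if_traceable[OF sun_pair_graph])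
  let ?path = "[8, 5, 9, 6, 10, 7, 11, 4, 0, 1, 2, 3]"
  show "successively (arc_rel sun_graph) ?path"
    unfolding sun_graph_simps sun_arcs_def sun_edges_def by simp
  show "set ?path = pverts sun_graph" unfolding sun_graph_simps by auto presburger
qed simp

lemma saturated_heads:
  fixes P :: "('a \<times> 'b) set"
  assumes "finite P" "inj_on snd P" "X \<subseteq> fst ` P" "\<And>e. \<lbrakk>e \<in> P; fst e \<in> X\<rbrakk> \<Longrightarrow> snd e \<in> Y"
    and Y: "finite Y" "card Y \<le> card X"
    and e: "e \<in> P" "snd e \<in> Y"
  shows "fst e \<in> X"
proof -
  define Q where "Q = {e \<in> P. fst e \<in> X}"
  have Q: "finite Q" "inj_on snd Q" "Q \<subseteq> P"
    using assms(1,2) unfolding Q_def by (auto intro: inj_on_subset)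
  have "X = fst ` Q" using assms(3) unfolding Q_def by auto
  then have "card X \<le> card Q" using Q(1) card_image_le by blast
  also have "card Q = card (snd ` Q)" using Q(2) by (simp add: card_image)
  finally have "card Y \<le> card (snd ` Q)" using Y(2) by simp
  moreover have "snd ` Q \<subseteq> Y" using assms(4) unfolding Q_def by auto
  ultimately have "snd ` Q = Y" using Y(1) by (metis card_seteq)
  then obtain e' where "e' \<in> Q" "snd e' = snd e" using e(2) by (metis imageE)
  then have "e = e'" using assms(2) e(1) Q(3) by (metis inj_onD subsetD)
  then show ?thesis using \<open>e' \<in> Q\<close> unfolding Q_def by simp
qed

lemma pcas_invariant:
  assumes "pcas u p v" "\<And>e. e \<in> set p \<Longrightarrow> fst e \<in> X \<longleftrightarrow> snd e \<in> X" "e \<in> set p"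
  shows "fst e \<in> X \<longleftrightarrow> u \<in> X"
  using assms
proof (induction p arbitrary: u)
  case (Cons f p)
  have "fst f \<in> X \<longleftrightarrow> snd f \<in> X" using Cons.prems(2) by simp
  moreover have "fst e \<in> X \<longleftrightarrow> snd f \<in> X" if "e \<in> set p" using Cons that by simp
  moreover have "fst f = u" "e = f \<or> e \<in> set p" using Cons.prems by simp_all
  ultimately show ?case by blast
qed simp

lemma sun_not_hamiltonian: "\<not> hamiltonian (with_proj sun_graph)"
proof
  assume "hamiltonian (with_proj sun_graph)"
  interpret pair_graph sun_graph by (rule sun_pair_graph)
  let ?inner = "{0, 1, 2, 3}" and ?ring = "{4, 5, 6, 7}" and ?tips = "{8, 9, 10, 11}"
  obtain p u where p: "awalk u p u" "distinct (tl (pawalk_verts u p))"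
    and cover: "fst ` set p = {..<12}"
    using \<open>hamiltonian _\<close> unfolding hamiltonian_def cycle_def by (auto simp: sun_graph_simps)
  have arcs: "set p \<subseteq> set sun_arcs" and cas: "pcas u p u"
    using p(1) unfolding awalk_def by (auto simp: sun_graph_simps)
  have inj: "inj_on snd (set p)"
    using p(2) unfolding tl_pawalk_verts[OF cas] by (simp add: distinct_map)
  have from_tips: "\<forall>e \<in> set sun_arcs. fst e \<in> ?tips \<longrightarrow> snd e \<in> ?ring"
    and from_inner: "\<forall>e \<in> set sun_arcs. fst e \<in> ?inner \<longrightarrow> snd e \<in> ?inner \<or> snd e \<in> ?ring"
    unfolding sun_arcs_def sun_edges_def by simp_all
  have into_ring: "fst e \<in> ?tips" if "e \<in> set p" "snd e \<in> ?ring" for e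
    by (rule saturated_heads[OF _ inj _ _ _ _ that]) (use cover from_tips arcs in auto)
  have leave_inner: "snd e \<in> ?inner" if "e \<in> set p" "fst e \<in> ?inner" for e
    using into_ring[OF that(1)] from_inner arcs that by fastforce
  have "fst e \<in> ?inner" if "e \<in> set p" "snd e \<in> ?inner" for e
    by (rule saturated_heads[OF _ inj _ _ _ _ that]) (use cover leave_inner in auto)
  then have trapped: "fst e \<in> ?inner \<longleftrightarrow> u \<in> ?inner" if "e \<in> set p" for e
    using pcas_invariant[OF cas _ that, of ?inner] leave_inner by blast
  have "0 \<in> fst ` set p" "4 \<in> fst ` set p" using cover by auto
  then obtain e f where "e \<in> set p" "fst e = 0" "f \<in> set p" "fst f = 4" by (metis imageE)
  then show False using trapped[of e] trapped[of f] by simp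
qed

theorem theorem1:
  shows "(\<forall>G :: 'a pair_pre_digraph.
            pair_graph G \<and> Digraph_Component.connected (with_proj G) \<and>
            locally_linear (with_proj G) \<and> \<not> hamiltonian (with_proj G) \<and>
            3 \<le> card (pverts G) \<longrightarrow> 12 \<le> card (pverts G)) \<and>
         (\<exists>G :: nat pair_pre_digraph.
            pair_graph G \<and> Digraph_Component.connected (with_proj G) \<and>
            locally_linear (with_proj G) \<and> \<not> hamiltonian (with_proj G) \<and>
            card (pverts G) = 12)"
proof (intro conjI allI impI)
  fix G :: "'a pair_pre_digraph"
  assume G: "pair_graph G \<and> Digraph_Component.connected (with_proj G) \<and>
    locally_linear (with_proj G) \<and> \<not> hamiltonian (with_proj G) \<and> 3 \<le> card (pverts G)"
  then interpret locally_linear_graph "pverts G" "arc_rel G"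
    using locally_linear_graph_digraph by blast
  show "12 \<le> card (pverts G)"
    using nonhamiltonian_card_bound hamiltonianI[of G] G by blast
next
  have "card (pverts sun_graph) = 12" by (simp add: sun_graph_simps)
  then show "\<exists>G :: nat pair_pre_digraph.
            pair_graph G \<and> Digraph_Component.connected (with_proj G) \<and>
            locally_linear (with_proj G) \<and> \<not> hamiltonian (with_proj G) \<and>
            card (pverts G) = 12"
    using sun_pair_graph sun_connected sun_locally_linear sun_not_hamiltonian by blast
qed

end
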